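(* Let $q>1$ be a prime power and let $t,k,n$ be integers with $1\le t<k\le n$ and $n\ge 2k$. Assume that there exists at least one $q$-Steiner system with parameters $(t,k,n)$, i.e. $S_q(t,k,n)\neq\emptyset$. Let $\mathfrak V_q(t,k,n)=\operatorname{span}_{\mathbb Q}\{\chi_{\mathfrak B}\mid \mathfrak B\in S_q(t,k,n)\}$ be the $\mathbb Q$-vector space spanned by the characteristic vectors of all these $q$-Steiner systems. Then $$\dim_{\mathbb Q}\mathfrak V_q(t,k,n)={n\brack k}_q-{n\brack t}_q+1.$$
   Context: $\mathbb F_q$ is the finite field with $q$ elements, and $\mathrm{Gr}_{n,k}(\mathbb F_q)$ is the set of all $k$-dimensional subspaces of $\mathbb F_q^n$. The Gaussian binomial coefficient is ${n\brack k}_q=\frac{(q^n-1)(q^{n-1}-1)\cdots(q^{n-k+1}-1)}{(q^k-1)(q^{k-1}-1)\cdots(q-1)}$, with ${n\brack 0}_q=1$; one has $\#\mathrm{Gr}_{n,k}(\mathbb F_q)={n\brack k}_q$. A $q$-Steiner system with parameters $(t,k,n)$ is a subset $\mathfrak B\subseteq \mathrm{Gr}_{n,k}(\mathbb F_q)$ (whose elements are called blocks) such that every $t$-dimensional subspace of $\mathbb F_q^n$ is contained in exactly one element of $\mathfrak B$. $S_q(t,k,n)$ denotes the set of all such $\mathfrak B$. The characteristic vector $\chi_{\mathfrak B}\in\{0,1\}^{{n\brack k}_q}$ is indexed by $\mathrm{Gr}_{n,k}(\mathbb F_q)$; its $A$-entry is $1$ if $A\in\mathfrak B$ and $0$ otherwise.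 *)

theory Defs
  imports "HOL-Analysis.Analysis"
begin

definition gauss_binomial :: "nat \<Rightarrow> nat \<Rightarrow> nat \<Rightarrow> rat" where
  "gauss_binomial q n k =
     (\<Prod>i<k. (of_nat q ^ (n - i) - 1)) / (\<Prod>i<k. (of_nat q ^ (k - i) - 1))"

text \<open>
  The space \<open>F_q^n\<close> is the type \<open>'a ^ 'n\<close> over a finite field type \<open>'a\<close>, with
  \<open>q = CARD('a)\<close> and \<open>n = CARD('n)\<close>; these two parameters are therefore carried by the
  types and not by explicit arguments.
\<close>

definition Gr :: "nat \<Rightarrow> ('a::{field,finite} ^ 'n::finite) set set" where
  "Gr k = {U. vec.subspace U \<and> vec.dim U = k}"

definition q_steiner_systems :: "nat \<Rightarrow> nat \<Rightarrow> ('a::{field,finite} ^ 'n::finite) set set set" where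
  "q_steiner_systems t k = {B. B \<subseteq> Gr k \<and> (\<forall>T \<in> Gr t. \<exists>!A. A \<in> B \<and> T \<subseteq> A)}"

text \<open>
  Since \<open>Gr k\<close> depends on the number \<open>k\<close>, it is not a type; the coordinates are indexed by all
  subsets of \<open>F_q^n\<close>. For \<open>B \<subseteq> Gr k\<close> the coordinates outside \<open>Gr k\<close> are 0, so this is the
  characteristic vector over \<open>Gr k\<close> extended by zero.
\<close>

definition char_vec :: "('a::{field,finite} ^ 'n::finite) set set \<Rightarrow> rat ^ (('a ^ 'n) set)" where
  "char_vec B = (\<chi> A. if A \<in> B then 1 else 0)"

definition steiner_space ::
    "('a::{field,finite} ^ 'n::finite) itself \<Rightarrow> nat \<Rightarrow> nat \<Rightarrow> (rat ^ (('a ^ 'n) set)) set" where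
  "steiner_space _ t k = vec.span {char_vec B | B. B \<in> q_steiner_systems t k}"

end

theory Submission imports Defs begin

text \<open>
  Let \<open>W\<close> be the incidence matrix of \<open>t\<close>-spaces against \<open>k\<close>-spaces. Every Steiner system lies in
  the space of all \<open>f\<close> on \<open>Gr k\<close> for which \<open>W f\<close> is constant; since \<open>W\<close> has full row rank, this
  space has the claimed dimension. It remains to see that a function \<open>g\<close> on \<open>Gr k\<close> orthogonal to
  all Steiner systems lies in the row space of \<open>W\<close>. Starting from \<open>j = k\<close>, suppose that \<open>g\<close> is
  induced from a function \<open>h\<close> on \<open>Gr j\<close> with \<open>t < j\<close>. Averaging a Steiner system over the
  stabiliser of \<open>J0 \<in> Gr j\<close> gives a \<open>GL\<close>-invariant kernel that annihilates \<open>h\<close> and acts as a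
  scalar modulo the functions induced from \<open>Gr (j - 1)\<close>. The scalar is evaluated on a zonal
  function: it is, up to a nonzero factor, an alternating sum over \<open>t < i \<le> j\<close> whose terms strictly
  increase in absolute value (this uses \<open>n \<ge> 2 k\<close>), so it is nonzero and \<open>h\<close> is itself induced
  from \<open>Gr (j - 1)\<close>.
\<close>

section \<open>Gaussian binomial coefficients\<close>

lemma gauss_binomial_0 [simp]: "gauss_binomial q n 0 = 1"
  by (simp add: gauss_binomial_def)

lemma power_minus_1_pos:
  assumes "q \<ge> 2" "m > 0"
  shows "(of_nat q ^ m - 1 :: rat) > 0"
  using assms one_less_power[of "of_nat q :: rat" m] by simp

lemma gauss_binomial_pos:
  assumes "q \<ge> 2" "k \<le> n"
  shows "gauss_binomial q n k > 0"
  unfolding gauss_binomial_def using assms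
  by (intro divide_pos_pos prod_pos ballI power_minus_1_pos) auto

lemma gauss_binomial_self [simp]:
  assumes "q \<ge> 2"
  shows "gauss_binomial q n n = 1"
proof -
  have "(\<Prod>i<n. (of_nat q ^ (n - i) - 1 :: rat)) > 0"
    using assms by (intro prod_pos ballI power_minus_1_pos) auto
  then show ?thesis unfolding gauss_binomial_def by (intro divide_self) linarith
qed

text \<open>The numerator contains the factor for \<open>i = n\<close>, which is
  \<open>q ^ 0 - 1\<close>.\<close>

lemma gauss_binomial_eq_0 [simp]:
  assumes "n < k"
  shows "gauss_binomial q n k = 0"
  using assms unfolding gauss_binomial_def by (auto intro!: bexI[of _ n])

lemma gauss_binomial_1: "gauss_binomial q n (Suc 0) = (of_nat q ^ n - 1) / (of_nat q - 1)"
  by (simp add: gauss_binomial_def)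

lemma gauss_binomial_Suc_Suc:
  "gauss_binomial q (Suc n) (Suc k) =
     gauss_binomial q n k * (of_nat q ^ Suc n - 1) / (of_nat q ^ Suc k - 1)"
  by (simp add: gauss_binomial_def prod.lessThan_Suc_shift mult_ac del: power_Suc prod.lessThan_Suc)

lemma gauss_binomial_Suc_right:
  "gauss_binomial q n (Suc k) =
     gauss_binomial q n k * (of_nat q ^ (n - k) - 1) / (of_nat q ^ Suc k - 1)"
proof -
  have "(\<Prod>i<Suc k. (of_nat q ^ (Suc k - i) - 1 :: rat)) =
      (of_nat q ^ Suc k - 1) * (\<Prod>i<k. of_nat q ^ (k - i) - 1)"
    by (simp add: prod.lessThan_Suc_shift del: power_Suc prod.lessThan_Suc)
  then show ?thesis
    by (simp add: gauss_binomial_def del: power_Suc)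
qed

lemma gauss_binomial_Suc_self:
  assumes "q \<ge> 2"
  shows "gauss_binomial q (Suc r) r = gauss_binomial q (Suc r) (Suc 0)"
proof (induction r)
  case (Suc r)
  have "gauss_binomial q (Suc (Suc r)) (Suc r) =
      gauss_binomial q (Suc r) r * (of_nat q ^ Suc (Suc r) - 1) / (of_nat q ^ Suc r - 1)"
    by (rule gauss_binomial_Suc_Suc)
  with Suc power_minus_1_pos[OF assms, of "Suc r"] show ?case
    by (simp add: gauss_binomial_1)
qed (simp add: assms)

text \<open>Both sides count the chains of an \<open>r\<close>-space in an
  \<open>(r + 1)\<close>-space of an \<open>m\<close>-space; \<open>card_Gr_between\<close> uses
  this identity to close its double count.\<close>

lemma gauss_binomial_Suc_mult:
  assumes "q \<ge> 2"
  shows "gauss_binomial q m (Suc r) * gauss_binomial q (Suc r) r =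
    gauss_binomial q m r * gauss_binomial q (m - r) (Suc 0)"
  using power_minus_1_pos[OF assms, of "Suc r"]
  by (simp add: gauss_binomial_Suc_self[OF assms] gauss_binomial_1 gauss_binomial_Suc_right
      del: power_Suc)

section \<open>Counting subspaces\<close>

lemma two_le_CARD_field: "2 \<le> CARD('a::{field,finite})"
  using card_mono[of "UNIV :: 'a set" "{0, 1}"] by simp

lemma power_CARD_minus_1_pos:
  "m > 0 \<Longrightarrow> (of_nat CARD('a::{field,finite}) ^ m - 1 :: rat) > 0"
  by (rule power_minus_1_pos[OF two_le_CARD_field])

lemma gauss_binomial_CARD_neq_0:
  "k \<le> n \<Longrightarrow> gauss_binomial CARD('a::{field,finite}) n k \<noteq> 0"
  using gauss_binomial_pos[OF two_le_CARD_field[where 'a='a]] by fastforce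

text \<open>A new basis vector \<open>x\<close> multiplies the size by the size of the field, since
  the pairs \<open>(c, y)\<close> correspond to the vectors \<open>c *s x + y\<close>.\<close>

lemma card_span_independent:
  fixes b :: "('a::{field,finite} ^ 'n::finite) set"
  assumes "vec.independent b"
  shows "card (vec.span b) = CARD('a) ^ card b"
  using vec.finiteI_independent[OF assms] assms
proof (induction b)
  case (insert x b)
  let ?f = "\<lambda>(c, y). c *s x + y"
  have x: "x \<notin> vec.span b" and b: "vec.independent b"
    using insert by (auto simp: vec.independent_insert)
  have inj: "inj_on ?f (UNIV \<times> vec.span b)"
  proof (rule inj_onI, clarsimp)
    fix c d :: 'a and y z :: "'a ^ 'n"
    assume y: "y \<in> vec.span b" and z: "z \<in> vec.span b" and eq: "c *s x + y = d *s x + z"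
    have "c = d"
    proof (rule ccontr)
      assume "c \<noteq> d"
      have "(c - d) *s x = z - y"
        using eq by (simp add: vec.scale_left_diff_distrib algebra_simps)
      then have "(c - d) *s x \<in> vec.span b"
        using y z vec.span_diff by metis
      then show False
        using \<open>c \<noteq> d\<close> x vec.span_scale[of "(c - d) *s x" b "inverse (c - d)"]
        unfolding vec.scale_scale by simp
    qed
    with eq show "c = d \<and> y = z" by simp
  qed
  have "vec.span (insert x b) = ?f ` (UNIV \<times> vec.span b)"
  proof safe
    fix y assume "y \<in> vec.span (insert x b)"
    then obtain k where "y - k *s x \<in> vec.span b" by (auto simp: vec.span_insert)
    then show "y \<in> ?f ` (UNIV \<times> vec.span b)"
      by (intro image_eqI[of _ _ "(k, y - k *s x)"]) auto
  next
    fix c y assume "y \<in> vec.span b"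
    then show "c *s x + y \<in> vec.span (insert x b)"
      by (auto simp: vec.span_insert intro!: exI[of _ c])
  qed
  then have "card (vec.span (insert x b)) = card (UNIV \<times> vec.span b :: ('a \<times> _) set)"
    using inj by (simp add: card_image)
  also have "\<dots> = CARD('a) * CARD('a) ^ card b"
    using insert.IH b by (simp add: card_cartesian_product)
  finally show ?case using insert.hyps by simp
qed simp

lemma card_subspace:
  fixes U :: "('a::{field,finite} ^ 'n::finite) set"
  assumes "vec.subspace U"
  shows "card U = CARD('a) ^ vec.dim U"
  using vec.basis_subspace_exists[OF assms] card_span_independent by metis

section \<open>Levels of intervals in the subspace lattice\<close>

definition Gr_between ::
    "nat \<Rightarrow> ('a::{field,finite} ^ 'n::finite) set \<Rightarrow> ('a ^ 'n) set \<Rightarrow> ('a ^ 'n) set set" where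
  "Gr_between i A B = {U \<in> Gr i. A \<subseteq> U \<and> U \<subseteq> B}"

lemma Gr_dim: "U \<in> Gr i \<Longrightarrow> vec.dim U = i"
  by (auto simp: Gr_def)

lemma Gr_mono: "U \<in> Gr i \<Longrightarrow> V \<in> Gr j \<Longrightarrow> U \<subseteq> V \<Longrightarrow> i \<le> j"
  using vec.dim_subset Gr_dim by metis

lemma Gr_eq: "U \<in> Gr i \<Longrightarrow> V \<in> Gr i \<Longrightarrow> U \<subseteq> V \<Longrightarrow> U = V"
  by (rule vec.subspace_dim_equal) (auto simp: Gr_def)

lemma Gr_0: "Gr 0 = {{0 :: 'a::{field,finite} ^ 'n::finite}}"
  using vec.subspace_0 by (auto simp: Gr_def vec.subspace_single_0)

lemma zero_in_Gr_0 [simp]: "{0} \<in> Gr 0"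
  by (simp add: Gr_0)

lemma UNIV_in_Gr: "(UNIV :: ('a::{field,finite} ^ 'n::finite) set) \<in> Gr CARD('n)"
  by (simp add: Gr_def vec_dim_card del: vec.dim_UNIV)

lemma zero_subset_Gr: "U \<in> Gr i \<Longrightarrow> {0} \<subseteq> U"
  by (simp add: Gr_def vec.subspace_0)

lemma Gr_conv_between: "Gr i = Gr_between i {0} UNIV"
  using zero_subset_Gr by (auto simp: Gr_between_def)

lemma Gr_subspace_exists:
  assumes "U \<in> Gr m" "i \<le> m"
  obtains J where "J \<in> Gr i" "J \<subseteq> U"
proof -
  have "i \<le> vec.dim U" and U: "vec.span U = U"
    using assms by (auto simp: Gr_def vec.span_eq_iff[THEN iffD2])
  from this(1) obtain J where "vec.subspace J" "J \<subseteq> vec.span U" "vec.dim J = i"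
    by (rule vec.choose_subspace_of_subspace)
  then show ?thesis using U by (intro that[of J]) (simp_all add: Gr_def)
qed

lemma span_insert_in_Gr:
  assumes "A \<in> Gr a" "x \<notin> A"
  shows "vec.span (insert x A) \<in> Gr (Suc a)"
  using assms vec.dim_insert[of x A] by (simp add: Gr_def vec.span_eq_iff[THEN iffD2])

text \<open>The sets \<open>U - A\<close> with \<open>U\<close> in the interval partition
  \<open>B - A\<close>, because a vector of \<open>U\<close> outside \<open>A\<close> already
  determines \<open>U\<close>. Each has \<open>q ^ Suc a - q ^ a\<close> elements.\<close>

lemma card_Gr_between_Suc:
  fixes A B :: "('a::{field,finite} ^ 'n::finite) set"
  assumes A: "A \<in> Gr a" and B: "B \<in> Gr b" and AB: "A \<subseteq> B"
  shows "of_nat (card (Gr_between (Suc a) A B)) = gauss_binomial CARD('a) (b - a) (Suc 0)"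
proof -
  let ?S = "Gr_between (Suc a) A B" and ?q = "CARD('a)"
  have "a \<le> b" using A B AB Gr_mono by blast
  have U: "U = vec.span (insert x A)" if "U \<in> ?S" "x \<in> U - A" for U x
  proof -
    have "vec.span (insert x A) \<subseteq> U"
      using that by (intro vec.span_minimal) (auto simp: Gr_between_def Gr_def)
    then show ?thesis
      using that span_insert_in_Gr[OF A, of x] Gr_eq by (fastforce simp: Gr_between_def)
  qed
  have un: "B - A = (\<Union>U\<in>?S. U - A)"
  proof safe
    fix x assume x: "x \<in> B" "x \<notin> A"
    have "vec.span (insert x A) \<subseteq> B"
      using x AB B by (intro vec.span_minimal) (auto simp: Gr_def)
    then have "vec.span (insert x A) \<in> ?S"
      using span_insert_in_Gr[OF A x(2)] vec.span_superset by (fastforce simp: Gr_between_def)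
    moreover have "x \<in> vec.span (insert x A)" by (simp add: vec.span_base)
    ultimately show "x \<in> (\<Union>U\<in>?S. U - A)" using x by blast
  qed (auto simp: Gr_between_def)
  have "card (B - A) = (\<Sum>U\<in>?S. card (U - A))"
    unfolding un by (intro card_UN_disjoint) (use U in auto)
  also have "\<dots> = (\<Sum>U\<in>?S. ?q ^ Suc a - ?q ^ a)"
    by (intro sum.cong refl) (use A in \<open>auto simp: Gr_between_def card_Diff_subset Gr_def card_subspace\<close>)
  finally have "?q ^ b - ?q ^ a = card ?S * (?q ^ Suc a - ?q ^ a)"
    using A B AB by (simp add: card_Diff_subset Gr_def card_subspace)
  then have "rat_of_nat (?q ^ b - ?q ^ a) = of_nat (card ?S) * of_nat (?q ^ Suc a - ?q ^ a)"
    by (metis of_nat_mult)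
  then have "of_nat ?q ^ a * (rat_of_nat ?q ^ (b - a) - 1) =
      of_nat ?q ^ a * (of_nat (card ?S) * (of_nat ?q - 1))"
    using \<open>a \<le> b\<close> two_le_CARD_field[where 'a='a]
    by (simp add: of_nat_diff power_increasing algebra_simps flip: power_add)
  then have "rat_of_nat ?q ^ (b - a) - 1 = of_nat (card ?S) * (of_nat ?q - 1)"
    using two_le_CARD_field[where 'a='a] by simp
  then show ?thesis
    using power_CARD_minus_1_pos[of 1, where 'a='a] by (simp add: gauss_binomial_1)
qed

text \<open>Both sides run over the flags \<open>A\<close> \<subseteq> \<open>I\<close> \<subseteq>
  \<open>J\<close> \<subseteq> \<open>B\<close>.\<close>

lemma sum_Gr_between_swap:
  fixes f :: "('a::{field,finite} ^ 'n::finite) set \<Rightarrow> ('a ^ 'n) set \<Rightarrow> 'b::comm_monoid_add"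
  shows "(\<Sum>J\<in>Gr_between j A B. \<Sum>I\<in>Gr_between i A J. f I J) =
    (\<Sum>I\<in>Gr_between i A B. \<Sum>J\<in>Gr_between j I B. f I J)"
proof -
  have "(\<Sum>J\<in>Gr_between j A B. \<Sum>I\<in>Gr_between i A J. f I J) =
      (\<Sum>J\<in>Gr_between j A B. \<Sum>I | I \<in> Gr_between i A B \<and> I \<subseteq> J. f I J)"
    by (intro sum.cong refl) (auto simp: Gr_between_def)
  also have "\<dots> = (\<Sum>I\<in>Gr_between i A B. \<Sum>J | J \<in> Gr_between j A B \<and> I \<subseteq> J. f I J)"
    by (rule sum.swap_restrict) auto
  also have "\<dots> = (\<Sum>I\<in>Gr_between i A B. \<Sum>J\<in>Gr_between j I B. f I J)"
    by (intro sum.cong refl) (auto simp: Gr_between_def)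
  finally show ?thesis .
qed

text \<open>Flags with \<open>I\<close> of dimension \<open>k\<close> and \<open>J\<close> of
  dimension \<open>Suc k\<close> are counted in two ways, which carries the formula from
  \<open>k\<close> to \<open>Suc k\<close>. The number of \<open>I\<close> inside a given
  \<open>J\<close> comes from the outer induction on \<open>b - a\<close>; this needs
  \<open>Suc k < b\<close>, so the top level \<open>b = Suc k\<close> stands apart.\<close>

lemma card_Gr_between:
  fixes A B :: "('a::{field,finite} ^ 'n::finite) set"
  assumes "A \<in> Gr a" "B \<in> Gr b" "A \<subseteq> B" "a \<le> k"
  shows "of_nat (card (Gr_between k A B)) = gauss_binomial CARD('a) (b - a) (k - a)"
  using assms
proof (induction "b - a" arbitrary: b B k rule: less_induct)
  case less
  have "a \<le> b" using less.prems Gr_mono by blast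
  show ?case
    using \<open>a \<le> k\<close>
  proof (induction k rule: dec_induct)
    case base
    have "Gr_between a A B = {A}"
      using less.prems by (auto simp: Gr_between_def dest: Gr_eq)
    then show ?case by simp
  next
    case (step k)
    consider "b < Suc k" | "b = Suc k" | "Suc k < b" by linarith
    then show ?case
    proof cases
      case 1
      then have "Gr_between (Suc k) A B = {}"
        using less.prems Gr_mono by (fastforce simp: Gr_between_def)
      with 1 \<open>a \<le> b\<close> show ?thesis by simp
    next
      case 2
      then have "Gr_between (Suc k) A B = {B}"
        using less.prems by (auto simp: Gr_between_def dest: Gr_eq)
      with 2 show ?thesis using gauss_binomial_self[OF two_le_CARD_field[where 'a='a]] by simp
    next
      case 3
      let ?g = "gauss_binomial CARD('a)" and ?N = "\<lambda>k. rat_of_nat (card (Gr_between k A B))"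
      have r: "Suc k - a = Suc (k - a)" "b - k = b - a - (k - a)" using step by auto
      have "?N (Suc k) * ?g (Suc (k - a)) (k - a) =
          (\<Sum>J\<in>Gr_between (Suc k) A B. \<Sum>I\<in>Gr_between k A J. 1)"
      proof -
        have "of_nat (card (Gr_between k A J)) = ?g (Suc (k - a)) (k - a)"
          if "J \<in> Gr_between (Suc k) A B" for J
          using less.hyps[of "Suc k" J k] that step less.prems 3
          by (auto simp: Gr_between_def r)
        then show ?thesis by simp
      qed
      also have "\<dots> = (\<Sum>I\<in>Gr_between k A B. \<Sum>J\<in>Gr_between (Suc k) I B. 1)"
        by (rule sum_Gr_between_swap)
      also have "\<dots> = ?N k * ?g (b - k) (Suc 0)"
      proof -
        have "of_nat (card (Gr_between (Suc k) I B)) = ?g (b - k) (Suc 0)"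
          if "I \<in> Gr_between k A B" for I
          using card_Gr_between_Suc[of I k B b] that less.prems by (auto simp: Gr_between_def)
        then show ?thesis by simp
      qed
      also have "\<dots> = ?g (b - a) (Suc (k - a)) * ?g (Suc (k - a)) (k - a)"
        using step.IH gauss_binomial_Suc_mult[OF two_le_CARD_field[where 'a='a], of "b - a" "k - a"]
        by (simp only: r mult_ac)
      finally show ?thesis
        using gauss_binomial_pos[of "CARD('a)" "k - a" "Suc (k - a)"] two_le_CARD_field[where 'a='a]
        by (simp add: r)
    qed
  qed
qed

lemma card_Gr:
  "of_nat (card (Gr k :: ('a::{field,finite} ^ 'n::finite) set set)) =
     gauss_binomial CARD('a) CARD('n) k"
  unfolding Gr_conv_between using card_Gr_between[OF zero_in_Gr_0 UNIV_in_Gr, of k] by simp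

text \<open>Each \<open>I\<close> is counted once for every \<open>J\<close> between
  \<open>I\<close> and \<open>B\<close>. Hence inducing a function from level \<open>i\<close>
  through level \<open>j\<close> differs from inducing it directly only by a constant
  factor.\<close>

lemma sum_Gr_between_down:
  fixes f :: "('a::{field,finite} ^ 'n::finite) set \<Rightarrow> rat"
  assumes "B \<in> Gr b" "i \<le> j"
  shows "(\<Sum>J\<in>Gr_between j A B. \<Sum>I\<in>Gr_between i A J. f I) =
    gauss_binomial CARD('a) (b - i) (j - i) * (\<Sum>I\<in>Gr_between i A B. f I)"
proof -
  have "of_nat (card (Gr_between j I B)) = gauss_binomial CARD('a) (b - i) (j - i)"
    if "I \<in> Gr_between i A B" for I
    using card_Gr_between[of I i B b j] that assms by (auto simp: Gr_between_def)
  then show ?thesis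
    by (simp add: sum_Gr_between_swap sum_distrib_left)
qed

text \<open>Dually, each \<open>J\<close> is counted once for every \<open>I\<close> between
  \<open>A\<close> and \<open>J\<close>.\<close>

lemma sum_Gr_between_up:
  fixes f :: "('a::{field,finite} ^ 'n::finite) set \<Rightarrow> rat"
  assumes "A \<in> Gr a" "a \<le> i"
  shows "(\<Sum>I\<in>Gr_between i A B. \<Sum>J\<in>Gr_between j I B. f J) =
    gauss_binomial CARD('a) (j - a) (i - a) * (\<Sum>J\<in>Gr_between j A B. f J)"
proof -
  have "of_nat (card (Gr_between i A J)) = gauss_binomial CARD('a) (j - a) (i - a)"
    if "J \<in> Gr_between j A B" for J
    using card_Gr_between[of A a J j i] that assms by (auto simp: Gr_between_def)
  then show ?thesis
    by (simp add: sum_Gr_between_swap[symmetric] sum_distrib_left)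
qed

section \<open>The general linear group acting on pairs of subspaces\<close>

definition GL :: "('a::field ^ 'n::finite \<Rightarrow> 'a ^ 'n) set" where
  "GL = {f. Vector_Spaces.linear (*s) (*s) f \<and> bij f}"

lemma GL_compose: "f \<in> GL \<Longrightarrow> g \<in> GL \<Longrightarrow> f \<circ> g \<in> GL"
  unfolding GL_def using bij_comp Vector_Spaces.linear_compose by blast

lemma GL_inv: 
  assumes "f \<in> GL"
  shows "inv f \<in> GL"
proof -
  have "bij f" and lin: "Vector_Spaces.linear (*s) (*s) f" using assms by (auto simp: GL_def)
  then have f: "f (inv f x) = x" for x by (simp add: bij_is_surj surj_f_inv_f)
  have "inj f" using \<open>bij f\<close> by (rule bij_is_inj)
  interpret f: Vector_Spaces.linear "(*s)" "(*s)" f by (rule lin)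
  have "inv f (x + y) = inv f x + inv f y" "inv f (c *s x) = c *s inv f x" for x y c
    by (rule injD[OF \<open>inj f\<close>], simp add: f f.add f.scale)+
  then show ?thesis
    using \<open>bij f\<close> lin by (auto simp: GL_def bij_imp_bij_inv Vector_Spaces.linear_iff)
qed

lemma GL_image_Gr:
  assumes "f \<in> GL" "U \<in> Gr i"
  shows "f ` U \<in> Gr i"
proof -
  have lin: "Vector_Spaces.linear (*s) (*s) f" and inj: "inj f"
    using assms by (auto simp: GL_def bij_is_inj)
  have "vec.dim (f ` U) = vec.dim U"
    by (rule vec.dim_image_eq[OF lin]) (use inj inj_on_subset in blast)
  then show ?thesis
    using assms vec.linear_subspace_image[OF lin] by (simp add: Gr_def)
qed

lemma GL_image_inv:
  assumes "f \<in> GL"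
  shows "f ` (inv f ` U) = U" "inv f ` (f ` U) = U"
  using assms by (auto simp: GL_def image_comp bij_is_surj bij_is_inj surj_iff[THEN iffD1] inv_o_cancel)

lemma GL_image_subset_iff: "f \<in> GL \<Longrightarrow> f ` U \<subseteq> f ` V \<longleftrightarrow> U \<subseteq> V"
  by (simp add: GL_def bij_is_inj inj_image_subset_iff)

lemma bij_betw_GL_Gr:
  assumes "f \<in> GL"
  shows "bij_betw ((`) f) (Gr i) (Gr i)"
  by (rule bij_betw_byWitness[where f' = "(`) (inv f)"])
    (auto simp: GL_image_inv[OF assms] GL_image_Gr assms GL_inv)

text \<open>A basis of \<open>A \<inter> B\<close> is extended to bases \<open>C\<close> of
  \<open>A\<close> and \<open>D\<close> of \<open>B\<close>, and their union to a basis of the whole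
  space. The blocks are lists so that the bases adapted to two pairs can be matched entry by
  entry.\<close>

lemma adapted_basis:
  fixes A B :: "('a::{field,finite} ^ 'n::finite) set"
  assumes A: "A \<in> Gr a" and B: "B \<in> Gr b"
  obtains us vs ws xs :: "('a ^ 'n) list" where
    "distinct (us @ vs @ ws @ xs)" "vec.independent (set (us @ vs @ ws @ xs))"
    "vec.span (set (us @ vs @ ws @ xs)) = UNIV"
    "vec.span (set (us @ vs)) = A" "vec.span (set (us @ ws)) = B"
    "length us = vec.dim (A \<inter> B)" "length (us @ vs) = a" "length (us @ ws) = b"
    "length (us @ vs @ ws @ xs) = CARD('n)"
proof -
  have sA: "vec.subspace A" and sB: "vec.subspace B" and dA: "vec.dim A = a" and dB: "vec.dim B = b"
    using A B by (auto simp: Gr_def)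
  define d where "d = vec.dim (A \<inter> B)"
  obtain I where I: "vec.independent I" "I \<subseteq> A \<inter> B" "vec.span I = A \<inter> B" "card I = d"
    using vec.basis_subspace_exists[OF vec.subspace_inter[OF sA sB]] unfolding d_def by metis
  obtain C where C: "I \<subseteq> C" "C \<subseteq> A" "vec.independent C" "A \<subseteq> vec.span C"
    using vec.maximal_independent_subset_extend[of I A] I by blast
  obtain D where D: "I \<subseteq> D" "D \<subseteq> B" "vec.independent D" "B \<subseteq> vec.span D"
    using vec.maximal_independent_subset_extend[of I B] I by blast
  have spC: "vec.span C = A" and spD: "vec.span D = B"
    using C D sA sB vec.span_minimal by blast+
  have cC: "card C = a" and cD: "card D = b"
    using vec.dim_span_eq_card_independent C(3) D(3) spC spD dA dB by metis+
  have sum: "vec.span (C \<union> D) = {x + y | x y. x \<in> A \<and> y \<in> B}"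
    unfolding vec.span_Un spC spD ..
  then have dim: "vec.dim (C \<union> D) + d = a + b"
    using vec.dim_sums_Int[OF sA sB] unfolding dA dB d_def sum[symmetric] by simp
  \<comment> \<open>The dimensions of the sum and of the intersection also add up to
    \<open>a + b\<close>. With the two inequalities that follow, this forces
    \<open>C \<union> D\<close> to have as many elements as its dimension, which makes it
    independent.\<close>
  have "card (C \<union> D) + card (C \<inter> D) = a + b"
    using card_Un_Int[of C D] cC cD by simp
  moreover have "card I \<le> card (C \<inter> D)" using C D by (intro card_mono) auto
  moreover have "vec.dim (C \<union> D) \<le> card (C \<union> D)" by (rule vec.dim_le_card') simp
  ultimately have "card (C \<inter> D) = d" and cardCD: "card (C \<union> D) = vec.dim (C \<union> D)"
    using I dim by linarith+
  then have I_eq: "I = C \<inter> D"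
    using C D I by (intro card_subset_eq) auto
  have ind: "vec.independent (C \<union> D)"
    by (rule vec.card_le_dim_spanning[OF order.refl vec.span_superset]) (use cardCD in auto)
  define E where "E = vec.extend_basis (C \<union> D)"
  have E: "vec.independent E" "C \<union> D \<subseteq> E" "vec.span E = UNIV"
    using vec.independent_extend_basis[OF ind] vec.extend_basis_superset[OF ind]
      vec.span_extend_basis[OF ind] unfolding E_def by auto
  have cE: "card E = CARD('n)"
    using vec.dim_span_eq_card_independent[OF E(1)] E(3) vec_dim_card by metis
  obtain us where us: "set us = I" "distinct us" using finite_distinct_list[of I] by auto
  obtain vs where vs: "set vs = C - I" "distinct vs" using finite_distinct_list[of "C - I"] by auto
  obtain ws where ws: "set ws = D - I" "distinct ws" using finite_distinct_list[of "D - I"] by auto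
  obtain xs where xs: "set xs = E - (C \<union> D)" "distinct xs"
    using finite_distinct_list[of "E - (C \<union> D)"] by auto
  have s: "set (us @ vs) = C" "set (us @ ws) = D" "set (us @ vs @ ws @ xs) = E"
    using us vs ws xs C D E by auto
  have dist: "distinct (us @ vs @ ws @ xs)" "distinct (us @ vs)" "distinct (us @ ws)"
    using us vs ws xs C D E I_eq by auto
  show ?thesis
  proof (rule that[of us vs ws xs])
    show "length us = vec.dim (A \<inter> B)" using us I(4) distinct_card d_def by metis
    show "length (us @ vs) = a" "length (us @ ws) = b" "length (us @ vs @ ws @ xs) = CARD('n)"
      using dist[THEN distinct_card] s cC cD cE by simp_all
  qed (use dist s E spC spD in auto)
qed

text \<open>Matching adapted bases of the two pairs gives the map; equal intersection dimensions
  make the blocks equally long.\<close>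

lemma GL_transitive_pairs:
  fixes A B :: "('a::{field,finite} ^ 'n::finite) set"
  assumes "A \<in> Gr a" "A' \<in> Gr a" "B \<in> Gr b" "B' \<in> Gr b"
    and dim: "vec.dim (A \<inter> B) = vec.dim (A' \<inter> B')"
  shows "\<exists>f \<in> GL. f ` A = A' \<and> f ` B = B'"
proof -
  obtain us vs ws xs :: "('a ^ 'n) list" where 1:
    "distinct (us @ vs @ ws @ xs)" "vec.independent (set (us @ vs @ ws @ xs))"
    "vec.span (set (us @ vs @ ws @ xs)) = UNIV"
    "vec.span (set (us @ vs)) = A" "vec.span (set (us @ ws)) = B"
    "length us = vec.dim (A \<inter> B)" "length (us @ vs) = a" "length (us @ ws) = b"
    "length (us @ vs @ ws @ xs) = CARD('n)"
    using adapted_basis[OF assms(1,3)] .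
  obtain us' vs' ws' xs' :: "('a ^ 'n) list" where 2:
    "distinct (us' @ vs' @ ws' @ xs')" "vec.independent (set (us' @ vs' @ ws' @ xs'))"
    "vec.span (set (us' @ vs' @ ws' @ xs')) = UNIV"
    "vec.span (set (us' @ vs')) = A'" "vec.span (set (us' @ ws')) = B'"
    "length us' = vec.dim (A' \<inter> B')" "length (us' @ vs') = a" "length (us' @ ws') = b"
    "length (us' @ vs' @ ws' @ xs') = CARD('n)"
    using adapted_basis[OF assms(2,4)] .
  let ?l = "us @ vs @ ws @ xs" and ?l' = "us' @ vs' @ ws' @ xs'"
  have len: "length us = length us'" "length vs = length vs'" "length ws = length ws'"
    "length xs = length xs'"
    using 1 2 dim by auto
  \<comment> \<open>\<open>h\<close> sends each entry of \<open>?l\<close> to the entry of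
    \<open>?l'\<close> at the same position.\<close>
  define h where "h x = the (map_of (zip ?l ?l') x)" for x
  obtain f where lin: "Vector_Spaces.linear (*s) (*s) f" and f: "\<forall>x\<in>set ?l. f x = h x"
    using vec.linear_independent_extend[OF 1(2), of h] by blast
  have "map f ?l = ?l'"
  proof (rule nth_equalityI)
    show "length (map f ?l) = length ?l'" using len by simp
    fix i assume "i < length (map f ?l)"
    then have i: "i < length ?l" by (simp only: length_map)
    have "f (?l ! i) = h (?l ! i)"
      using f i nth_mem by blast
    also have "\<dots> = ?l' ! i"
      unfolding h_def using map_of_zip_nth[OF _ 1(1), of ?l' i] i 1(9) 2(9) by simp
    finally show "map f ?l ! i = ?l' ! i" using i by (simp only: nth_map)
  qed
  then have m: "map f us = us'" "map f vs = vs'" "map f ws = ws'" "map f xs = xs'"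
    using len by auto
  have im: "f ` set (us @ vs) = set (us' @ vs')" "f ` set (us @ ws) = set (us' @ ws')"
    "f ` set ?l = set ?l'"
    by (simp_all add: image_Un flip: m)
  note sp = vec.linear_span_image[OF lin, symmetric]
  have fAB: "f ` A = A'" "f ` B = B'" and surj: "f ` UNIV = UNIV"
    using sp[of "set (us @ vs)"] sp[of "set (us @ ws)"] sp[of "set ?l"] 
    unfolding im 1(3-5) 2(3-5) by auto
  have "bij f"
    using surj by (simp add: bij_def finite_UNIV_surj_inj)
  with lin have "f \<in> GL" by (simp add: GL_def)
  with fAB show ?thesis by blast
qed

text \<open>By \<open>GL_transitive_pairs\<close> the orbits on pairs are the fibres of the
  intersection dimension, and \<open>F\<close> is constant on orbits.\<close>

lemma GL_invariant_dim_Int: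
  fixes F :: "('a::{field,finite} ^ 'n::finite) set \<Rightarrow> ('a ^ 'n) set \<Rightarrow> 'c"
  assumes inv: "\<And>f A B. f \<in> GL \<Longrightarrow> A \<in> Gr a \<Longrightarrow> B \<in> Gr b \<Longrightarrow> F (f ` A) (f ` B) = F A B"
  shows "\<exists>\<phi>. \<forall>A \<in> Gr a. \<forall>B \<in> Gr b. F A B = \<phi> (vec.dim (A \<inter> B))"
proof -
  \<comment> \<open>The value at any pair with intersection dimension \<open>d\<close>; where no
    such pair exists the choice is arbitrary.\<close>
  define \<phi> where "\<phi> d = (SOME c. \<exists>A \<in> Gr a. \<exists>B \<in> Gr b. vec.dim (A \<inter> B) = d \<and> F A B = c)" for d
  have "F A B = \<phi> (vec.dim (A \<inter> B))" if AB: "A \<in> Gr a" "B \<in> Gr b" for A B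
  proof -
    have "\<exists>A' \<in> Gr a. \<exists>B' \<in> Gr b. vec.dim (A' \<inter> B') = vec.dim (A \<inter> B) \<and> F A' B' = \<phi> (vec.dim (A \<inter> B))"
      unfolding \<phi>_def by (rule someI[of _ "F A B"]) (use AB in auto)
    then obtain A' B' where *: "A' \<in> Gr a" "B' \<in> Gr b" "vec.dim (A' \<inter> B') = vec.dim (A \<inter> B)"
      and F: "F A' B' = \<phi> (vec.dim (A \<inter> B))" by auto
    obtain f where "f \<in> GL" "f ` A' = A" "f ` B' = B"
      using GL_transitive_pairs[OF *(1) AB(1) *(2) AB(2) *(3)] by auto
    with inv[of f A' B'] * F show ?thesis by simp
  qed
  then show ?thesis by blast
qed

section \<open>Injectivity of the incidence map\<close>

text \<open>The dimension formula for the sum of the two spans is compared with inclusion-exclusion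
  for \<open>X\<close> and \<open>Y\<close>.\<close>

lemma dim_Int_spans:
  fixes X Y :: "('a::field ^ 'n::finite) set"
  assumes "vec.independent (X \<union> Y)"
  shows "vec.dim (vec.span X \<inter> vec.span Y) = card (X \<inter> Y)"
proof -
  have "vec.independent X" "vec.independent Y"
    using assms vec.independent_mono by blast+
  then have "vec.dim (X \<union> Y) + vec.dim (vec.span X \<inter> vec.span Y) = card X + card Y"
    using vec.dim_sums_Int[OF vec.subspace_span vec.subspace_span, of X Y]
    unfolding vec.span_Un[symmetric] by (simp add: vec.dim_eq_card_independent)
  moreover have "card (X \<union> Y) + card (X \<inter> Y) = card X + card Y"
    using card_Un_Int[of X Y] \<open>vec.independent X\<close> \<open>vec.independent Y\<close>
    by (simp add: vec.finiteI_independent)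
  ultimately show ?thesis
    using vec.dim_eq_card_independent[OF assms] by simp
qed

text \<open>Vectors from the last block of an adapted basis are added to \<open>A\<close>; they do
  not enlarge the intersection with \<open>B\<close>, and \<open>k + b \<le> CARD('n)\<close> makes
  the block long enough. This supplies the nonzero diagonal of the triangular system below.\<close>

lemma extension_with_same_intersection:
  fixes A B :: "('a::{field,finite} ^ 'n::finite) set"
  assumes A: "A \<in> Gr a" and B: "B \<in> Gr b" and "a \<le> k" "k + b \<le> CARD('n)"
  obtains K where "K \<in> Gr k" "A \<subseteq> K" "vec.dim (K \<inter> B) = vec.dim (A \<inter> B)"
proof -
  obtain us vs ws xs :: "('a ^ 'n) list" where 1:
    "distinct (us @ vs @ ws @ xs)" "vec.independent (set (us @ vs @ ws @ xs))"
    "vec.span (set (us @ vs @ ws @ xs)) = UNIV"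
    "vec.span (set (us @ vs)) = A" "vec.span (set (us @ ws)) = B"
    "length us = vec.dim (A \<inter> B)" "length (us @ vs) = a" "length (us @ ws) = b"
    "length (us @ vs @ ws @ xs) = CARD('n)"
    using adapted_basis[OF A B] .
  define ys where "ys = take (k - a) xs"
  have sub: "set ys \<subseteq> set xs" and dist: "distinct ys"
    using 1(1) by (auto simp: ys_def dest: in_set_takeD)
  have len: "length ys = k - a"
    using 1(7-9) assms(3,4) by (simp add: ys_def)
  let ?X = "set (us @ vs @ ys)" and ?Y = "set (us @ ws)"
  have ind: "vec.independent (?X \<union> ?Y)"
    by (rule vec.independent_mono[OF 1(2)]) (use sub in auto)
  have "vec.independent ?X" by (rule vec.independent_mono[OF ind]) auto
  moreover have "distinct (us @ vs @ ys)" using 1(1) sub dist by auto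
  ultimately have "vec.dim (vec.span ?X) = k"
    using len 1(7) assms(3) by (simp add: vec.dim_eq_card_independent distinct_card del: set_append)
  then have "vec.span ?X \<in> Gr k" by (simp add: Gr_def del: vec.dim_span)
  moreover have "A \<subseteq> vec.span ?X"
    unfolding 1(4)[symmetric] by (rule vec.span_mono) auto
  moreover have "vec.dim (vec.span ?X \<inter> B) = vec.dim (A \<inter> B)"
  proof -
    have "?X \<inter> ?Y = set us" using 1(1) sub by auto
    then show ?thesis
      using dim_Int_spans[OF ind] 1(1,5,6) by (simp add: distinct_card del: set_append)
  qed
  ultimately show ?thesis using that by blast
qed

text \<open>For fixed \<open>T0\<close>, summing the hypothesis over the \<open>K\<close> with \<open>vec.dim (K \<inter> T0) = s\<close> gives
  a triangular system for the sums of \<open>c\<close> over the spheres around \<open>T0\<close>.\<close>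

lemma incidence_injective:
  fixes c :: "('a::{field,finite} ^ 'n::finite) set \<Rightarrow> rat"
  assumes "t \<le> k" "t + k \<le> CARD('n)"
    and zero: "\<And>K. K \<in> Gr k \<Longrightarrow> (\<Sum>T\<in>Gr_between t {0} K. c T) = 0"
    and T0: "T0 \<in> Gr t"
  shows "c T0 = 0"
proof -
  \<comment> \<open>Invariance under \<open>GL\<close> makes this number a function of the
    intersection dimension, so the system can be written in the sphere sums
    \<open>C d\<close>.\<close>
  define w where "w s T T0 = card {K \<in> Gr k. T \<subseteq> K \<and> vec.dim (K \<inter> T0) = s}"
    for s and T T0 :: "('a ^ 'n) set"
  have winv: "w s (f ` T) (f ` T') = w s T T'" if "f \<in> GL" "T \<in> Gr t" "T' \<in> Gr t" for f s T T'
  proof -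
    have dim: "vec.dim (f ` K \<inter> f ` T') = vec.dim (K \<inter> T')" if "K \<in> Gr k" for K
    proof -
      have "f ` K \<inter> f ` T' = f ` (K \<inter> T')"
        using \<open>f \<in> GL\<close> by (simp add: GL_def bij_is_inj image_Int)
      moreover have "K \<inter> T' \<in> Gr (vec.dim (K \<inter> T'))"
        using \<open>T' \<in> Gr t\<close> \<open>K \<in> Gr k\<close> by (simp add: Gr_def vec.subspace_inter)
      ultimately show ?thesis using Gr_dim[OF GL_image_Gr[OF \<open>f \<in> GL\<close>]] by simp
    qed
    have "bij_betw ((`) f) {K \<in> Gr k. T \<subseteq> K \<and> vec.dim (K \<inter> T') = s}
        {K \<in> Gr k. f ` T \<subseteq> K \<and> vec.dim (K \<inter> f ` T') = s}"
      using bij_betw_GL_Gr[OF that(1), of k]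
      by (rule bij_betw_Collect) (simp add: dim GL_image_subset_iff that)
    then show ?thesis
      unfolding w_def by (rule bij_betw_same_card[symmetric])
  qed
  have "\<exists>\<phi>. \<forall>T \<in> Gr t. \<forall>T' \<in> Gr t. w s T T' = \<phi> (vec.dim (T \<inter> T'))" for s
    by (rule GL_invariant_dim_Int) (rule winv)
  then obtain \<phi> where \<phi>: "T \<in> Gr t \<Longrightarrow> T' \<in> Gr t \<Longrightarrow> w s T T' = \<phi> s (vec.dim (T \<inter> T'))" for s T T'
    by metis
  define C where "C d = (\<Sum>T | T \<in> Gr t \<and> vec.dim (T \<inter> T0) = d. c T)" for d
  have dim_le: "vec.dim (T \<inter> T0) \<le> t" for T
    using vec.dim_subset[of "T \<inter> T0" T0] T0 by (simp add: Gr_def)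
  have C0: "C s = 0" if "s \<le> t" for s
    using that
  proof (induction s rule: less_induct)
    case (less s)
    have "0 = (\<Sum>K | K \<in> Gr k \<and> vec.dim (K \<inter> T0) = s. \<Sum>T\<in>Gr_between t {0} K. c T)"
      by (simp add: zero)
    also have "\<dots> = (\<Sum>K | K \<in> Gr k \<and> vec.dim (K \<inter> T0) = s. \<Sum>T | T \<in> Gr t \<and> T \<subseteq> K. c T)"
      using zero_subset_Gr by (intro sum.cong refl) (auto simp: Gr_between_def)
    also have "\<dots> = (\<Sum>T\<in>Gr t. \<Sum>K | K \<in> {K. K \<in> Gr k \<and> vec.dim (K \<inter> T0) = s} \<and> T \<subseteq> K. c T)"
      by (rule sum.swap_restrict) auto
    also have "\<dots> = (\<Sum>T\<in>Gr t. of_nat (\<phi> s (vec.dim (T \<inter> T0))) * c T)"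
    proof (rule sum.cong[OF refl])
      fix T :: "('a ^ 'n) set" assume "T \<in> Gr t"
      have "{K \<in> {K. K \<in> Gr k \<and> vec.dim (K \<inter> T0) = s}. T \<subseteq> K} = 
          {K \<in> Gr k. T \<subseteq> K \<and> vec.dim (K \<inter> T0) = s}" by auto
      then show "(\<Sum>K | K \<in> {K. K \<in> Gr k \<and> vec.dim (K \<inter> T0) = s} \<and> T \<subseteq> K. c T) =
          of_nat (\<phi> s (vec.dim (T \<inter> T0))) * c T"
        using \<phi>[OF \<open>T \<in> Gr t\<close> T0, of s] by (simp add: w_def)
    qed
    also have "\<dots> = (\<Sum>d\<le>t. \<Sum>T | T \<in> Gr t \<and> vec.dim (T \<inter> T0) = d. of_nat (\<phi> s (vec.dim (T \<inter> T0))) * c T)"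
      by (rule sum.group[symmetric]) (use dim_le in auto)
    also have "\<dots> = (\<Sum>d\<le>t. of_nat (\<phi> s d) * C d)"
      by (intro sum.cong refl) (auto simp: C_def sum_distrib_left)
    \<comment> \<open>Terms with \<open>d < s\<close> vanish by induction. For \<open>d > s\<close>
      no \<open>K\<close> above \<open>T\<close> can meet \<open>T0\<close> in dimension only
      \<open>s\<close>, unless there is no such \<open>T\<close> at all and \<open>C d\<close> is an
      empty sum.\<close>
    also have "\<dots> = (\<Sum>d\<in>{s}. of_nat (\<phi> s d) * C d)"
    proof (rule sum.mono_neutral_right)
      show "\<forall>d\<in>{..t} - {s}. of_nat (\<phi> s d) * C d = 0"
      proof
        fix d assume d: "d \<in> {..t} - {s}"
        show "of_nat (\<phi> s d) * C d = 0"
        proof (cases "d < s")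
          case True
          with less show ?thesis by simp
        next
          case False
          have "\<phi> s d = 0 \<or> {T. T \<in> Gr t \<and> vec.dim (T \<inter> T0) = d} = {}"
          proof (rule disjCI, rule ccontr)
            assume "{T. T \<in> Gr t \<and> vec.dim (T \<inter> T0) = d} \<noteq> {}" "\<phi> s d \<noteq> 0"
            then obtain T where T: "T \<in> Gr t" "vec.dim (T \<inter> T0) = d" by auto
            with \<phi>[OF T(1) T0, of s] \<open>\<phi> s d \<noteq> 0\<close> obtain K where
              K: "T \<subseteq> K" "vec.dim (K \<inter> T0) = s"
              unfolding w_def by (metis (mono_tags, lifting) card.empty empty_Collect_eq)
            have "vec.dim (T \<inter> T0) \<le> vec.dim (K \<inter> T0)"
              using K by (intro vec.dim_subset) auto
            with d False K T show False by simp
          qed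
          then show ?thesis
            unfolding C_def by (elim disjE) (simp, metis sum.empty mult_zero_right)
        qed
      qed
    qed (use less in auto)
    finally have zero_s: "of_nat (\<phi> s s) * C s = 0" by simp
    \<comment> \<open>The diagonal coefficient: some \<open>K\<close> above \<open>T\<close> meets
      \<open>T0\<close> in the same dimension as \<open>T\<close> does.\<close>
    have pos: "\<phi> s s \<noteq> 0" if T: "T \<in> Gr t" "vec.dim (T \<inter> T0) = s" for T :: "('a ^ 'n) set"
    proof -
      obtain K where "K \<in> Gr k" "T \<subseteq> K" "vec.dim (K \<inter> T0) = s"
        using extension_with_same_intersection[OF T(1) T0, of k] assms(1,2) T(2)
        by (metis add.commute)
      then have "w s T T0 \<noteq> 0"
        unfolding w_def by auto
      with \<phi>[OF T(1) T0, of s] T(2) show ?thesis by simp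
    qed
    show "C s = 0"
    proof (cases "{T. T \<in> Gr t \<and> vec.dim (T \<inter> T0) = s} = {}")
      case True
      show ?thesis unfolding C_def True by simp
    next
      case False
      then obtain T where T: "T \<in> Gr t" "vec.dim (T \<inter> T0) = s" by blast
      with pos[OF T] zero_s show ?thesis by simp
    qed
  qed
  \<comment> \<open>The last sphere is a single point, so \<open>C t\<close> is the value
    \<open>c T0\<close>.\<close>
  have "{T. T \<in> Gr t \<and> vec.dim (T \<inter> T0) = t} = {T0}"
  proof -
    have "T = T0" if T: "T \<in> Gr t" "vec.dim (T \<inter> T0) = t" for T
    proof -
      have "T \<inter> T0 \<in> Gr t" using T T0 by (simp add: Gr_def vec.subspace_inter)
      then have "T \<inter> T0 = T" "T \<inter> T0 = T0" using T T0 Gr_eq by auto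
      then show "T = T0" by auto
    qed
    then show ?thesis using T0 Gr_dim by auto
  qed
  with C0[of t] show "c T0 = 0" by (simp add: C_def)
qed

section \<open>An alternating sum of Gaussian binomial coefficients\<close>

text \<open>If \<open>S\<close> is the signed sum up to \<open>b\<close>, the next one is
  \<open>u (Suc b) - S\<close>. The upper bound \<open>S \<le> u b\<close> is carried along because
  it keeps the next sum positive.\<close>

lemma alternating_sum_bounds:
  fixes u :: "nat \<Rightarrow> 'a::linordered_idom"
  assumes "a \<le> b"
    and pos: "\<And>i. a \<le> i \<Longrightarrow> i \<le> b \<Longrightarrow> 0 < u i"
    and mono: "\<And>i. a \<le> i \<Longrightarrow> i < b \<Longrightarrow> u i < u (Suc i)"
  shows "0 < (-1) ^ b * (\<Sum>i=a..b. (-1) ^ i * u i) \<and> (-1) ^ b * (\<Sum>i=a..b. (-1) ^ i * u i) \<le> u b"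
  using assms
proof (induction b rule: dec_induct)
  case base
  then show ?case by (simp flip: mult.assoc power_mult_distrib)
next
  case (step b)
  let ?S = "\<Sum>i=a..b. (-1) ^ i * u i"
  have IH: "0 < (-1) ^ b * ?S \<and> (-1) ^ b * ?S \<le> u b"
    by (rule step.IH) (use step.prems in auto)
  have "(-1) ^ Suc b * (\<Sum>i=a..Suc b. (-1) ^ i * u i) = u (Suc b) - (-1) ^ b * ?S"
    using step.hyps by (simp add: algebra_simps flip: power_add power_mult_distrib)
  with IH step.prems(2)[of b] step.hyps show ?case by linarith
qed

text \<open>The recursion is forced by requiring that the zonal function around \<open>J0 \<in> Gr j\<close> sums to zero
  over the \<open>j\<close>-spaces above any \<open>(j - 1)\<close>-space.\<close>

primrec zonal_coeff :: "nat \<Rightarrow> nat \<Rightarrow> nat \<Rightarrow> nat \<Rightarrow> rat" where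
  "zonal_coeff q n j 0 = 1"
| "zonal_coeff q n j (Suc i) = - zonal_coeff q n j i *
     (gauss_binomial q (n - j + 1) (Suc 0) - gauss_binomial q i (Suc 0)) / gauss_binomial q (j - i) (Suc 0)"

text \<open>Needed for the growth of the terms in \<open>zonal_sum_nonzero\<close>. The factor
  \<open>x ^ (j - i) - 1 \<ge> 1\<close> is dropped; the rest follows from
  \<open>k + 1 \<le> n - j + 1\<close>, and this is where \<open>2 * k \<le> n\<close>
  enters.\<close>

lemma power_product_inequality:
  fixes x :: "'a::linordered_idom"
  assumes x: "2 \<le> x" and ij: "i < j" and jk: "j \<le> k" and kn: "2 * k \<le> n"
  shows "(x ^ (i + 1) - 1) * (x ^ (k - i) - 1) \<le> (x ^ (n - j + 1) - x ^ i) * (x ^ (j - i) - 1)"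
proof -
  have x1: "1 \<le> x ^ m" for m using x by (intro one_le_power) simp
  have j1: "1 \<le> x ^ (j - i) - 1"
  proof -
    have "x ^ 1 \<le> x ^ (j - i)" using x ij by (intro power_increasing) auto
    with x show ?thesis by simp
  qed
  have "x ^ i * x ^ (k - i + 1) = x ^ (k + 1)" using ij jk by (simp flip: power_add)
  also have "\<dots> \<le> x ^ (n - j + 1)" using x ij jk kn by (intro power_increasing) auto
  finally have big: "x ^ i * (x * x ^ (k - i)) \<le> x ^ (n - j + 1)" by simp
  have "(x ^ (i + 1) - 1) * (x ^ (k - i) - 1) \<le> x ^ (i + 1) * (x ^ (k - i) - 1)"
    using x1 by (intro mult_right_mono) auto
  also have "\<dots> = x ^ i * (x * x ^ (k - i)) - x ^ i * x" by (simp add: algebra_simps)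
  also have "\<dots> \<le> x ^ (n - j + 1) - x ^ i"
  proof (rule diff_mono[OF big])
    show "x ^ i \<le> x ^ i * x" using mult_left_mono[of 1 x "x ^ i"] x x1[of i] by simp
  qed
  also have "\<dots> \<le> (x ^ (n - j + 1) - x ^ i) * (x ^ (j - i) - 1)"
  proof -
    have "x ^ i \<le> x ^ (n - j + 1)" using x ij jk kn by (intro power_increasing) auto
    then show ?thesis using mult_left_mono[OF j1, of "x ^ (n - j + 1) - x ^ i"] by simp
  qed
  finally show ?thesis .
qed

text \<open>Once the signs are split off, the terms are positive and strictly increasing, so
  \<open>alternating_sum_bounds\<close> applies. The sum is the one that arises in
  \<open>sum_zonal_vec_covered\<close>.\<close>

lemma zonal_sum_nonzero:
  fixes q n k j t :: nat
  assumes q: "2 \<le> q" and tj: "t < j" and jk: "j \<le> k" and kn: "2 * k \<le> n"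
  defines "\<kappa> \<equiv> gauss_binomial q (k - t) (j - t) / gauss_binomial q (n - t) (j - t)"
  shows "(\<Sum>i=Suc t..j. zonal_coeff q n j i * gauss_binomial q j i *
    (gauss_binomial q (k - i) (j - i) - \<kappa> * gauss_binomial q (n - i) (j - i))) \<noteq> 0"
proof -
  let ?g = "gauss_binomial q"
  define x where "x = rat_of_nat q"
  have x: "2 \<le> x" using q by (simp add: x_def)
  note g_def = gauss_binomial_1[of q, folded x_def]
  have xpos: "0 < x ^ m - 1" if "0 < m" for m
    using power_minus_1_pos[OF q that] by (simp add: x_def)
  have gpos: "0 < ?g a b" if "b \<le> a" for a b
    using gauss_binomial_pos[OF q that] .
  have kpos: "0 < \<kappa>"
    unfolding \<kappa>_def using jk kn by (intro divide_pos_pos gpos) auto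
  \<comment> \<open>The coefficients alternate in sign, and \<open>y\<close> is their absolute value
    for \<open>i \<le> j\<close>.\<close>
  define y where "y i = (-1) ^ i * zonal_coeff q n j i" for i
  define D where "D i = ?g (k - i) (j - i) - \<kappa> * ?g (n - i) (j - i)" for i
  define u where "u i = y i * ?g j i * D i" for i
  have y_Suc: "y (Suc i) = y i * (x ^ (n - j + 1) - x ^ i) / (x ^ (j - i) - 1)" for i
    unfolding y_def zonal_coeff.simps g_def using x
    by (simp add: diff_divide_distrib[symmetric] del: power_Suc) simp
  have npow: "0 < x ^ (n - j + 1) - x ^ i" if "i < j" for i
    using power_strict_increasing[of i "n - j + 1" x] x that jk kn by simp
  have ypos: "0 < y i" if "i \<le> j" for i
    using that
  proof (induction i)
    case (Suc i)
    with npow[of i] xpos[of "j - i"] show ?case by (simp add: y_Suc)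
  qed (simp add: y_def)
  \<comment> \<open>Passing to \<open>Suc i\<close> multiplies the two Gaussian binomials in
    \<open>D i\<close> by fractions with numerator \<open>x ^ (j - i) - 1\<close> and denominators
    \<open>x ^ (k - i) - 1\<close> and \<open>x ^ (n - i) - 1\<close>. As \<open>k < n\<close>, the
    subtracted one receives the smaller factor.\<close>
  have D_Suc: "D i * (x ^ (j - i) - 1) / (x ^ (k - i) - 1) < D (Suc i)" if "i < j" for i
  proof -
    have Suc: "k - i = Suc (k - Suc i)" "n - i = Suc (n - Suc i)" "j - i = Suc (j - Suc i)"
      using that jk kn by auto
    have lt: "x ^ (k - i) - 1 < x ^ (n - i) - 1"
      using x that jk kn by (intro diff_strict_right_mono power_strict_increasing) auto
    have p: "0 < x ^ (j - i) - 1" "0 < x ^ (k - i) - 1" "0 < x ^ (n - i) - 1"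
      using that jk kn by (intro xpos; simp)+
    have e: "?g (k - Suc i) (j - Suc i) = ?g (k - i) (j - i) * (x ^ (j - i) - 1) / (x ^ (k - i) - 1)"
      "?g (n - Suc i) (j - Suc i) = ?g (n - i) (j - i) * (x ^ (j - i) - 1) / (x ^ (n - i) - 1)"
      using p unfolding Suc gauss_binomial_Suc_Suc x_def[symmetric]
      by (simp_all del: power_Suc)
    have "\<kappa> * ?g (n - i) (j - i) * (x ^ (j - i) - 1) / (x ^ (n - i) - 1) <
        \<kappa> * ?g (n - i) (j - i) * (x ^ (j - i) - 1) / (x ^ (k - i) - 1)"
      using lt p kpos gpos[of "j - i" "n - i"] jk kn
      by (intro divide_strict_left_mono mult_pos_pos) auto
    then show ?thesis
      unfolding D_def e left_diff_distrib diff_divide_distrib times_divide_eq_right mult.assoc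
      by linarith
  qed
  \<comment> \<open>\<open>\<kappa>\<close> is the ratio that makes \<open>D\<close> vanish at
    \<open>t\<close>; by \<open>D_Suc\<close> positivity starts at \<open>Suc t\<close>.\<close>
  have "D t = 0"
  proof -
    have "?g (n - t) (j - t) \<noteq> 0" using gpos[of "j - t" "n - t"] jk kn by fastforce
    then show ?thesis by (simp add: D_def \<kappa>_def)
  qed
  have Dpos: "0 < D i" if "Suc t \<le> i" "i \<le> j" for i
    using that
  proof (induction i rule: dec_induct)
    case base
    then show ?case using D_Suc[of t] \<open>D t = 0\<close> tj by simp
  next
    case (step i)
    then have "0 < D i * (x ^ (j - i) - 1) / (x ^ (k - i) - 1)"
      using jk by (intro divide_pos_pos mult_pos_pos xpos) auto
    with D_Suc[of i] step show ?case by simp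
  qed
  have upos: "0 < u i" if "Suc t \<le> i" "i \<le> j" for i
    unfolding u_def using that by (intro mult_pos_pos ypos Dpos gpos)
  have umono: "u i < u (Suc i)" if "Suc t \<le> i" "i < j" for i
  proof -
    have p: "0 < x ^ (j - i) - 1" "0 < x ^ (k - i) - 1" "0 < x ^ Suc i - 1"
      using that jk by (intro xpos; simp)+
    \<comment> \<open>The factor on the right is the product of the exact ratios of \<open>y\<close>
      and of \<open>?g j\<close> between \<open>i\<close> and \<open>Suc i\<close> and of the lower
      bound that \<open>D_Suc\<close> gives for the ratio of \<open>D\<close>.\<close>
    have "u i \<le> u i * (((x ^ (n - j + 1) - x ^ i) * (x ^ (j - i) - 1)) /
        ((x ^ (i + 1) - 1) * (x ^ (k - i) - 1)))"
    proof -
      have "0 < (x ^ (i + 1) - 1) * (x ^ (k - i) - 1)"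
        using p by (intro mult_pos_pos) simp_all
      with power_product_inequality[OF x that(2) jk kn]
      have "1 \<le> (x ^ (n - j + 1) - x ^ i) * (x ^ (j - i) - 1) / ((x ^ (i + 1) - 1) * (x ^ (k - i) - 1))"
        by (subst le_divide_eq_1_pos) simp_all
      from mult_left_mono[OF this, of "u i"] show ?thesis
        using upos[of i] that by (simp only: mult_1_right less_imp_le)
    qed
    also have "\<dots> = y i * ?g j i * (x ^ (n - j + 1) - x ^ i) / (x ^ Suc i - 1) *
        (D i * (x ^ (j - i) - 1) / (x ^ (k - i) - 1))"
      by (simp add: u_def field_simps del: power_Suc)
    also have "\<dots> < y i * ?g j i * (x ^ (n - j + 1) - x ^ i) / (x ^ Suc i - 1) * D (Suc i)"
      using D_Suc[OF that(2)] ypos[of i] gpos[of i j] npow[OF that(2)] p that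
      by (intro mult_strict_left_mono divide_pos_pos mult_pos_pos) auto
    also have "\<dots> = u (Suc i)"
      unfolding u_def y_Suc gauss_binomial_Suc_right[of q j i, folded x_def] using p
      by (simp del: power_Suc)
    finally show ?thesis .
  qed
  have "zonal_coeff q n j i * ?g j i * (?g (k - i) (j - i) - \<kappa> * ?g (n - i) (j - i)) = (-1) ^ i * u i" for i
    unfolding u_def y_def D_def by (simp flip: mult.assoc power_mult_distrib)
  moreover have "(\<Sum>i=Suc t..j. (-1) ^ i * u i) \<noteq> 0"
    using alternating_sum_bounds[of "Suc t" j u] tj upos umono by fastforce
  ultimately show ?thesis by simp
qed

section \<open>Zonal functions\<close>

text \<open>A function of \<open>vec.dim (J0 \<inter> J)\<close>, expanded in the numbers of common
  \<open>i\<close>-spaces rather than in indicators of the dimension. A sum against it then splits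
  into sums over the \<open>J\<close> above a fixed \<open>I\<close> inside
  \<open>J0\<close>.\<close>

definition zonal ::
    "(nat \<Rightarrow> rat) \<Rightarrow> nat \<Rightarrow> ('a::{field,finite} ^ 'n::finite) set \<Rightarrow> ('a ^ 'n) set \<Rightarrow> rat" where
  "zonal \<nu> j J0 J = (\<Sum>i\<le>j. \<nu> i * of_nat (card (Gr_between i {0} (J0 \<inter> J))))"

lemma card_Gr_between_0:
  fixes U :: "('a::{field,finite} ^ 'n::finite) set"
  assumes "vec.subspace U"
  shows "of_nat (card (Gr_between i {0} U)) = gauss_binomial CARD('a) (vec.dim U) i"
  using card_Gr_between[of "{0}" 0 U "vec.dim U" i] assms vec.subspace_0
  by (auto simp: Gr_def)

lemma sum_zonal:
  fixes J0 :: "('a::{field,finite} ^ 'n::finite) set"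
  shows "(\<Sum>J\<in>X. zonal \<nu> j J0 J * h J) =
    (\<Sum>i\<le>j. \<nu> i * (\<Sum>I\<in>Gr_between i {0} J0. \<Sum>J | J \<in> X \<and> I \<subseteq> J. h J))"
proof -
  have "(\<Sum>J\<in>X. of_nat (card (Gr_between i {0} (J0 \<inter> J))) * h J) =
      (\<Sum>I\<in>Gr_between i {0} J0. \<Sum>J | J \<in> X \<and> I \<subseteq> J. h J)" for i
  proof -
    have "(\<Sum>J\<in>X. of_nat (card (Gr_between i {0} (J0 \<inter> J))) * h J) =
        (\<Sum>J\<in>X. \<Sum>I | I \<in> Gr_between i {0} J0 \<and> I \<subseteq> J. h J)"
      by (intro sum.cong refl) (auto simp: Gr_between_def intro!: arg_cong[where f=card])
    also have "\<dots> = (\<Sum>I\<in>Gr_between i {0} J0. \<Sum>J | J \<in> X \<and> I \<subseteq> J. h J)"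
      by (rule sum.swap_restrict) auto
    finally show ?thesis .
  qed
  then show ?thesis
    unfolding zonal_def sum_distrib_right
    by (subst sum.swap) (simp add: sum_distrib_left[symmetric] mult.assoc)
qed

section \<open>Zonal functions with vanishing sums over the \<open>j\<close>-spaces above a smaller
  space\<close>

lemma dim_Int_le:
  "vec.dim (I \<inter> K) \<le> vec.dim (I :: ('a::{field,finite} ^ 'n::finite) set)"
  by (rule vec.dim_subset) auto

text \<open>If \<open>I \<subseteq> K\<close>, every \<open>J\<close> qualifies, and the last
  summand cancels the subtracted Gaussian binomial. Otherwise \<open>J\<close> must be the sum of
  \<open>I\<close> and \<open>K\<close>, which has dimension \<open>Suc m\<close> only if
  \<open>I \<inter> K\<close> has dimension \<open>i - 1\<close>; the last summand is 1 or 0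
  accordingly. The case \<open>i = 0\<close> is split off because \<open>i - 1\<close>
  truncates.\<close>

lemma card_Gr_above_pair:
  fixes I K :: "('a::{field,finite} ^ 'n::finite) set"
  assumes I: "I \<in> Gr i" and K: "K \<in> Gr m"
  shows "of_nat (card {J \<in> Gr_between (Suc m) K UNIV. I \<subseteq> J}) =
    (gauss_binomial CARD('a) (CARD('n) - m) (Suc 0) - gauss_binomial CARD('a) i (Suc 0)) *
      (if I \<subseteq> K then 1 else 0) +
    (if i = 0 then 0 else of_nat (card (Gr_between (i - 1) {0} (I \<inter> K))))"
proof -
  let ?g = "gauss_binomial CARD('a)"
  have sI: "vec.subspace I" and dI: "vec.dim I = i" and sK: "vec.subspace K" and dK: "vec.dim K = m"
    using I K by (auto simp: Gr_def)
  note card0 = card_Gr_between_0[OF vec.subspace_inter[OF sI sK], of "i - 1"]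
  show ?thesis
  proof (cases "I \<subseteq> K")
    case True
    then have "{J \<in> Gr_between (Suc m) K UNIV. I \<subseteq> J} = Gr_between (Suc m) K UNIV"
      by (auto simp: Gr_between_def)
    moreover have "I \<inter> K = I" using True by auto
    moreover have "?g i (i - 1) = ?g i (Suc 0)" if "i \<noteq> 0"
      using that gauss_binomial_Suc_self[OF two_le_CARD_field[where 'a='a], of "i - 1"] by simp
    ultimately show ?thesis
      using card_Gr_between_Suc[OF K UNIV_in_Gr] True card0 dI by auto
  next
    case False
    define d where "d = vec.dim (I \<inter> K)"
    have "i \<noteq> 0" using False I zero_subset_Gr[OF K] by (auto simp: Gr_0)
    have "d < i"
    proof (rule ccontr)
      assume "\<not> d < i"
      then have "I \<inter> K = I"
        using sI sK dI by (intro vec.subspace_dim_equal) (auto simp: d_def vec.subspace_inter)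
      with False show False by auto
    qed
    let ?S = "vec.span (I \<union> K)"
    have "vec.span (I \<union> K) = {x + y | x y. x \<in> I \<and> y \<in> K}"
      unfolding vec.span_Un using sI sK by (simp add: vec.span_eq_iff[THEN iffD2])
    then have "vec.dim ?S + d = i + m"
      using vec.dim_sums_Int[OF sI sK] unfolding d_def dI dK by simp
    then have S: "?S \<in> Gr (i + m - d)" by (simp add: Gr_def)
    have iff: "J \<in> Gr_between (Suc m) K UNIV \<and> I \<subseteq> J \<longleftrightarrow> J \<in> Gr (Suc m) \<and> ?S \<subseteq> J" for J
    proof -
      have "?S \<subseteq> J \<longleftrightarrow> I \<union> K \<subseteq> J" if "vec.subspace J"
        using vec.span_minimal[OF _ that] vec.span_superset[of "I \<union> K"] by blast
      then show ?thesis by (auto simp: Gr_between_def Gr_def)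
    qed
    show ?thesis
    proof (cases "d = i - 1")
      case True
      then have "?S \<in> Gr (Suc m)" using S \<open>d < i\<close> by simp
      then have "{J \<in> Gr_between (Suc m) K UNIV. I \<subseteq> J} = {?S}"
        unfolding iff using Gr_eq by blast
      then show ?thesis
        using False \<open>i \<noteq> 0\<close> card0 True gauss_binomial_self[OF two_le_CARD_field[where 'a='a]]
        by (simp add: d_def)
    next
      case False
      have "\<not> (J \<in> Gr (Suc m) \<and> ?S \<subseteq> J)" for J
        using Gr_mono[OF S, of J "Suc m"] False \<open>d < i\<close> by auto
      then have "{J \<in> Gr_between (Suc m) K UNIV. I \<subseteq> J} = {}"
        unfolding iff by blast
      moreover have "?g d (i - 1) = 0" using False \<open>d < i\<close> by simp
      ultimately show ?thesis
        using \<open>\<not> I \<subseteq> K\<close> \<open>i \<noteq> 0\<close> card0 by (simp add: d_def)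
    qed
  qed
qed

abbreviation zonal_vec ::
    "nat \<Rightarrow> ('a::{field,finite} ^ 'n::finite) set \<Rightarrow> ('a ^ 'n) set \<Rightarrow> rat" where
  "zonal_vec j \<equiv> zonal (zonal_coeff CARD('a) CARD('n) j) j"

text \<open>The sum is a linear combination of the numbers \<open>N i\<close> of
  \<open>i\<close>-spaces in \<open>J0 \<inter> K\<close>, and the recursion of
  \<open>zonal_coeff\<close> annihilates the coefficient of \<open>N i\<close> for each
  \<open>i \<le> m\<close>.\<close>

lemma sum_zonal_vec_hyperplane:
  fixes J0 K :: "('a::{field,finite} ^ 'n::finite) set"
  assumes J0: "J0 \<in> Gr (Suc m)" and K: "K \<in> Gr m"
  shows "(\<Sum>J\<in>Gr_between (Suc m) K UNIV. zonal_vec (Suc m) J0 J) = 0"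
proof -
  let ?g = "gauss_binomial CARD('a)"
  let ?z = "zonal_coeff CARD('a) CARD('n) (Suc m)"
  define G where "G = ?g (CARD('n) - m) (Suc 0)"
  define N where "N i = rat_of_nat (card (Gr_between i {0} (J0 \<inter> K)))" for i
  have sK: "vec.subspace K" and dK: "vec.dim K = m" and sJ: "vec.subspace J0"
    using J0 K by (auto simp: Gr_def)
  have "m < CARD('n)" using Gr_mono[OF J0 UNIV_in_Gr] by simp
  \<comment> \<open>\<open>card_Gr_above_pair\<close> is summed over \<open>I\<close>; its last
    summand becomes a count of flags \<open>L\<close> \<subseteq> \<open>I\<close> \<subseteq>
    \<open>J0\<close> with \<open>L\<close> of dimension \<open>i - 1\<close> inside
    \<open>K\<close>.\<close>
  have inner: "(\<Sum>I\<in>Gr_between i {0} J0. \<Sum>J | J \<in> Gr_between (Suc m) K UNIV \<and> I \<subseteq> J. 1) =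
      (G - ?g i (Suc 0)) * N i + (if i = 0 then 0 else N (i - 1) * ?g (Suc m - (i - 1)) (Suc 0))" for i
  proof -
    have le: "(\<Sum>I\<in>Gr_between i {0} J0. if I \<subseteq> K then 1 else 0 :: rat) = N i"
      unfolding N_def by (subst sum.inter_filter[symmetric])
        (auto simp: Gr_between_def intro!: arg_cong[where f=card])
    have low: "(\<Sum>I\<in>Gr_between i {0} J0. of_nat (card (Gr_between (i - 1) {0} (I \<inter> K)))) =
        N (i - 1) * ?g (Suc m - (i - 1)) (Suc 0)" if "i \<noteq> 0"
    proof -
      have "(\<Sum>I\<in>Gr_between i {0} J0. of_nat (card (Gr_between (i - 1) {0} (I \<inter> K)))) =
          (\<Sum>I\<in>Gr_between i {0} J0. \<Sum>L\<in>Gr_between (i - 1) {0} I. if L \<subseteq> K then 1 else 0 :: rat)"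
        by (intro sum.cong refl, subst sum.inter_filter[symmetric])
          (auto simp: Gr_between_def intro!: arg_cong[where f=card])
      also have "\<dots> = (\<Sum>L\<in>Gr_between (i - 1) {0} J0. \<Sum>I\<in>Gr_between i L J0. if L \<subseteq> K then 1 else 0)"
        by (rule sum_Gr_between_swap)
      also have "\<dots> = (\<Sum>L\<in>Gr_between (i - 1) {0} J0. ?g (Suc m - (i - 1)) (Suc 0) * (if L \<subseteq> K then 1 else 0))"
        using card_Gr_between_Suc[OF _ J0, of _ "i - 1"] that
        by (intro sum.cong refl) (auto simp: Gr_between_def)
      also have "\<dots> = ?g (Suc m - (i - 1)) (Suc 0) * N (i - 1)"
        unfolding sum_distrib_left[symmetric] N_def by (subst sum.inter_filter[symmetric])
          (auto simp: Gr_between_def intro!: arg_cong[where f=card])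
      finally show ?thesis by (simp add: mult.commute)
    qed
    have "(\<Sum>I\<in>Gr_between i {0} J0. \<Sum>J | J \<in> Gr_between (Suc m) K UNIV \<and> I \<subseteq> J. 1) =
        (\<Sum>I\<in>Gr_between i {0} J0. (G - ?g i (Suc 0)) * (if I \<subseteq> K then 1 else 0) +
          (if i = 0 then 0 else of_nat (card (Gr_between (i - 1) {0} (I \<inter> K)))))"
      using card_Gr_above_pair[OF _ K, where i=i] unfolding G_def
      by (intro sum.cong refl) (simp add: Gr_between_def)
    also have "\<dots> = (G - ?g i (Suc 0)) * (\<Sum>I\<in>Gr_between i {0} J0. if I \<subseteq> K then 1 else 0) +
        (if i = 0 then 0 else (\<Sum>I\<in>Gr_between i {0} J0. of_nat (card (Gr_between (i - 1) {0} (I \<inter> K)))))"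
      by (simp add: sum.distrib sum_distrib_left)
    also have "\<dots> = (G - ?g i (Suc 0)) * N i +
        (if i = 0 then 0 else N (i - 1) * ?g (Suc m - (i - 1)) (Suc 0))"
    proof (cases "i = 0")
      case False
      show ?thesis by (simp only: le low[OF False] False if_False)
    next
      case True
      show ?thesis unfolding le by (simp only: True refl if_True)
    qed
    finally show ?thesis .
  qed
  \<comment> \<open>The top index has no partner in the recursion, but \<open>J0 \<inter> K\<close>
    has dimension at most \<open>m\<close>.\<close>
  have "N (Suc m) = 0"
  proof -
    have "vec.dim (J0 \<inter> K) \<le> m" using dim_Int_le[of K J0] dK by (simp add: Int_commute)
    then show ?thesis
      unfolding N_def card_Gr_between_0[OF vec.subspace_inter[OF sJ sK]] by simp
  qed
  have rec: "?z i * (G - ?g i (Suc 0)) + ?z (Suc i) * ?g (Suc m - i) (Suc 0) = 0" if "i \<le> m" for i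
  proof -
    have "?g (Suc m - i) (Suc 0) \<noteq> 0"
      by (rule gauss_binomial_CARD_neq_0) (use that in simp)
    \<comment> \<open>The two differences agree only because \<open>m < CARD('n)\<close>; otherwise
      the subtraction truncates.\<close>
    moreover have "CARD('n) - Suc m + 1 = CARD('n) - m" using \<open>m < CARD('n)\<close> by simp
    ultimately show ?thesis by (simp add: G_def)
  qed
  have "(\<Sum>J\<in>Gr_between (Suc m) K UNIV. zonal_vec (Suc m) J0 J * 1) =
      (\<Sum>i\<le>Suc m. ?z i * ((G - ?g i (Suc 0)) * N i +
        (if i = 0 then 0 else N (i - 1) * ?g (Suc m - (i - 1)) (Suc 0))))"
    unfolding sum_zonal inner ..
  also have "\<dots> = (\<Sum>i\<le>Suc m. ?z i * (G - ?g i (Suc 0)) * N i) +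
      (\<Sum>i\<le>Suc m. if i = 0 then 0 else ?z i * N (i - 1) * ?g (Suc m - (i - 1)) (Suc 0))"
    by (subst sum.distrib[symmetric], intro sum.cong refl) (simp add: algebra_simps)
  also have "\<dots> = (\<Sum>i\<le>m. ?z i * (G - ?g i (Suc 0)) * N i) +
      (\<Sum>i\<le>m. ?z (Suc i) * N i * ?g (Suc m - i) (Suc 0))"
    by (rule arg_cong2[where f="(+)"])
      (simp add: \<open>N (Suc m) = 0\<close> del: zonal_coeff.simps,
       simp add: sum.atMost_Suc_shift del: sum.atMost_Suc zonal_coeff.simps)
  also have "\<dots> = (\<Sum>i\<le>m. N i * (?z i * (G - ?g i (Suc 0)) + ?z (Suc i) * ?g (Suc m - i) (Suc 0)))"
    by (subst sum.distrib[symmetric], intro sum.cong refl) (simp only: algebra_simps)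
  also have "\<dots> = 0"
    by (rule sum.neutral) (simp add: rec del: zonal_coeff.simps)
  finally show ?thesis by simp
qed

text \<open>Up to a nonzero factor this is the total of the sums of
  \<open>sum_zonal_vec_hyperplane\<close> over the \<open>(j - 1)\<close>-spaces above
  \<open>K\<close>. Thus \<open>zonal_vec j J0\<close> is orthogonal to every function induced from
  a lower level.\<close>

lemma sum_zonal_vec_above:
  fixes J0 K :: "('a::{field,finite} ^ 'n::finite) set"
  assumes J0: "J0 \<in> Gr j" and K: "K \<in> Gr m" and "m < j"
  shows "(\<Sum>J\<in>Gr_between j K UNIV. zonal_vec j J0 J) = 0"
proof -
  obtain j' where j: "j = Suc j'" using \<open>m < j\<close> by (cases j) auto
  have "gauss_binomial CARD('a) (j - m) (j' - m) * (\<Sum>J\<in>Gr_between j K UNIV. zonal_vec j J0 J) =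
      (\<Sum>L\<in>Gr_between j' K UNIV. \<Sum>J\<in>Gr_between j L UNIV. zonal_vec j J0 J)"
    using \<open>m < j\<close> j by (subst sum_Gr_between_up[OF K]) auto
  also have "\<dots> = 0"
    using sum_zonal_vec_hyperplane[of J0 j'] J0 unfolding j
    by (intro sum.neutral) (simp add: Gr_between_def)
  finally show ?thesis
    using gauss_binomial_CARD_neq_0[of "j' - m" "j - m", where 'a='a] j by (simp add: diff_le_mono)
qed

section \<open>Counting in a Steiner system\<close>

lemma steiner_subset_Gr: "B \<in> q_steiner_systems t k \<Longrightarrow> B \<subseteq> Gr k"
  by (simp add: q_steiner_systems_def)

lemma steiner_block_ex1: "B \<in> q_steiner_systems t k \<Longrightarrow> T \<in> Gr t \<Longrightarrow> \<exists>!A. A \<in> B \<and> T \<subseteq> A"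
  unfolding q_steiner_systems_def by (elim CollectE conjE bspec)

text \<open>A \<open>t\<close>-space inside \<open>I\<close> already fixes the block.\<close>

lemma steiner_block_unique:
  fixes B :: "('a::{field,finite} ^ 'n::finite) set set"
  assumes B: "B \<in> q_steiner_systems t k" and "A \<in> B" "A' \<in> B"
    and I: "I \<in> Gr i" "t \<le> i" "I \<subseteq> A" "I \<subseteq> A'"
  shows "A = A'"
proof -
  obtain T where "T \<in> Gr t" "T \<subseteq> I"
    using Gr_subspace_exists[OF I(1,2)] .
  then have "T \<subseteq> A" "T \<subseteq> A'" using I by auto
  with B \<open>T \<in> Gr t\<close> \<open>A \<in> B\<close> \<open>A' \<in> B\<close> show ?thesis
    unfolding q_steiner_systems_def by blast
qed

text \<open>The shadow of \<open>B\<close> on level \<open>j\<close>. For \<open>t \<le> j\<close>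
  distinct blocks share no \<open>j\<close>-space, so summing over \<open>B\<close> a function
  induced from level \<open>j\<close> is the same as summing over the shadow.\<close>

definition covered :: "nat \<Rightarrow> ('a::{field,finite} ^ 'n::finite) set set \<Rightarrow> ('a ^ 'n) set set" where
  "covered j B = {J \<in> Gr j. \<exists>A\<in>B. J \<subseteq> A}"

lemma card_covered_above_large:
  fixes B :: "('a::{field,finite} ^ 'n::finite) set set"
  assumes B: "B \<in> q_steiner_systems t k" and A: "A \<in> B" "I \<subseteq> A"
    and I: "I \<in> Gr i" "t \<le> i" "i \<le> j"
  shows "of_nat (card {J \<in> covered j B. I \<subseteq> J}) = gauss_binomial CARD('a) (k - i) (j - i)"
proof -
  have "{J \<in> covered j B. I \<subseteq> J} = Gr_between j I A"
  proof (intro equalityI subsetI)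
    fix J assume "J \<in> {J \<in> covered j B. I \<subseteq> J}"
    then obtain A' where J: "J \<in> Gr j" "I \<subseteq> J" and A': "A' \<in> B" "J \<subseteq> A'"
      by (auto simp: covered_def)
    then have "A = A'"
      by (intro steiner_block_unique[OF B A(1) A'(1) I(1,2) A(2)]) auto
    then show "J \<in> Gr_between j I A" using J A' by (simp add: Gr_between_def)
  qed (use A in \<open>auto simp: covered_def Gr_between_def\<close>)
  moreover have "A \<in> Gr k" using B A by (auto simp: q_steiner_systems_def)
  ultimately show ?thesis using card_Gr_between[OF I(1) _ A(2) I(3)] by simp
qed

text \<open>Double counting with the \<open>t\<close>-spaces \<open>T\<close> between
  \<open>I\<close> and \<open>J\<close>, each of which lies in exactly one block. The result is a
  fixed proportion of all \<open>j\<close>-spaces above \<open>I\<close>, the same for every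
  \<open>i \<le> t\<close>.\<close>

lemma card_covered_above_small:
  fixes B :: "('a::{field,finite} ^ 'n::finite) set set"
  assumes B: "B \<in> q_steiner_systems t k" and I: "I \<in> Gr i" "i \<le> t" and tj: "t \<le> j" "j \<le> CARD('n)"
  shows "of_nat (card {J \<in> covered j B. I \<subseteq> J}) =
    gauss_binomial CARD('a) (k - t) (j - t) / gauss_binomial CARD('a) (CARD('n) - t) (j - t) *
    gauss_binomial CARD('a) (CARD('n) - i) (j - i)"
proof -
  let ?g = "gauss_binomial CARD('a)" and ?n = "CARD('n)"
  let ?X = "{J \<in> covered j B. I \<subseteq> J}"
  have "?g (j - i) (t - i) * of_nat (card ?X) = (\<Sum>J\<in>?X. \<Sum>T\<in>Gr_between t I J. 1)"
  proof -
    have "of_nat (card (Gr_between t I J)) = ?g (j - i) (t - i)" if "J \<in> ?X" for J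
      using that I by (intro card_Gr_between) (auto simp: covered_def)
    then show ?thesis by simp
  qed
  also have "\<dots> = (\<Sum>J\<in>?X. \<Sum>T | T \<in> Gr_between t I UNIV \<and> T \<subseteq> J. 1)"
    by (intro sum.cong refl) (auto simp: Gr_between_def)
  also have "\<dots> = (\<Sum>T\<in>Gr_between t I UNIV. \<Sum>J | J \<in> ?X \<and> T \<subseteq> J. 1)"
    by (rule sum.swap_restrict) auto
  also have "\<dots> = (\<Sum>T\<in>Gr_between t I UNIV. ?g (k - t) (j - t))"
  proof (rule sum.cong[OF refl])
    fix T assume T: "T \<in> Gr_between t I UNIV"
    then have "T \<in> Gr t" by (simp add: Gr_between_def)
    then obtain A where A: "A \<in> B" "T \<subseteq> A"
      using B unfolding q_steiner_systems_def by blast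
    have "{J. J \<in> ?X \<and> T \<subseteq> J} = {J \<in> covered j B. T \<subseteq> J}"
      using T by (auto simp: Gr_between_def)
    then show "(\<Sum>J | J \<in> ?X \<and> T \<subseteq> J. 1) = ?g (k - t) (j - t)"
      using card_covered_above_large[OF B A _ order.refl tj(1)] T by (simp add: Gr_between_def)
  qed
  also have "\<dots> = ?g (?n - i) (t - i) * ?g (k - t) (j - t)"
    using card_Gr_between[OF I(1) UNIV_in_Gr _ I(2)] by simp
  finally have 1: "?g (j - i) (t - i) * of_nat (card ?X) = ?g (?n - i) (t - i) * ?g (k - t) (j - t)" .
  \<comment> \<open>The flags \<open>I\<close> \<subseteq> \<open>T\<close> \<subseteq>
    \<open>J\<close> in the whole space, counted in two ways.\<close>
  have 2: "?g (?n - t) (j - t) * ?g (?n - i) (t - i) = ?g (j - i) (t - i) * ?g (?n - i) (j - i)"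
    using sum_Gr_between_up[OF I, where j=j and B=UNIV and f="\<lambda>_. 1"]
      sum_Gr_between_down[OF UNIV_in_Gr tj(1), where A=I and f="\<lambda>_. 1"]
      card_Gr_between[OF I(1) UNIV_in_Gr, of t] card_Gr_between[OF I(1) UNIV_in_Gr, of j] I tj
    unfolding sum_Gr_between_swap by simp
  have nz: "?g (j - i) (t - i) \<noteq> 0" "?g (?n - t) (j - t) \<noteq> 0"
    using I tj by (simp_all add: gauss_binomial_CARD_neq_0 diff_le_mono)
  have "?g (j - i) (t - i) * (of_nat (card ?X) * ?g (?n - t) (j - t)) =
      ?g (k - t) (j - t) * (?g (?n - t) (j - t) * ?g (?n - i) (t - i))"
    unfolding mult.assoc[symmetric] 1 by (simp add: mult_ac)
  then have "?g (j - i) (t - i) * (of_nat (card ?X) * ?g (?n - t) (j - t)) =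
      ?g (j - i) (t - i) * (?g (k - t) (j - t) * ?g (?n - i) (j - i))"
    unfolding 2 by (simp add: mult_ac)
  then show ?thesis using nz by (simp add: field_simps)
qed

text \<open>\<open>zonal_vec j J0\<close> sums to zero over \<open>Gr j\<close>, so \<kappa> times
  that sum may be subtracted. For \<open>i \<le> t\<close> the covered spaces are exactly the
  proportion \<kappa>, which leaves the terms with \<open>i > t\<close>.\<close>

lemma sum_zonal_vec_covered:
  fixes B :: "('a::{field,finite} ^ 'n::finite) set set"
  assumes B: "B \<in> q_steiner_systems t k" and J0: "J0 \<in> Gr j" and A: "A \<in> B" "J0 \<subseteq> A"
    and tj: "t < j"
  shows "(\<Sum>J\<in>covered j B. zonal_vec j J0 J) =
    (\<Sum>i=Suc t..j. zonal_coeff CARD('a) CARD('n) j i * gauss_binomial CARD('a) j i *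
      (gauss_binomial CARD('a) (k - i) (j - i) -
       gauss_binomial CARD('a) (k - t) (j - t) / gauss_binomial CARD('a) (CARD('n) - t) (j - t) *
       gauss_binomial CARD('a) (CARD('n) - i) (j - i)))"
proof -
  let ?g = "gauss_binomial CARD('a)" and ?n = "CARD('n)"
  let ?z = "zonal_coeff CARD('a) CARD('n) j"
  define \<kappa> where "\<kappa> = ?g (k - t) (j - t) / ?g (?n - t) (j - t)"
  define c where "c i = (if i \<le> t then \<kappa> * ?g (?n - i) (j - i) else ?g (k - i) (j - i))" for i
  have jn: "j \<le> ?n" using Gr_mono[OF J0 UNIV_in_Gr] by simp
  have card_i: "of_nat (card (Gr_between i {0} J0)) = ?g j i" for i
    using card_Gr_between[OF zero_in_Gr_0 J0 zero_subset_Gr[OF J0]] by simp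
  have "(\<Sum>J\<in>covered j B. zonal_vec j J0 J * 1) = (\<Sum>i\<le>j. ?z i * (?g j i * c i))"
    unfolding sum_zonal
  proof (intro sum.cong refl arg_cong2[where f="(*)"])
    fix i assume "i \<in> {..j}"
    have "(\<Sum>J | J \<in> covered j B \<and> I \<subseteq> J. 1) = c i" if "I \<in> Gr_between i {0} J0" for I
    proof (cases "i \<le> t")
      case True
      then show ?thesis
        using card_covered_above_small[OF B, of I i j] that tj jn
        by (simp add: c_def \<kappa>_def Gr_between_def)
    next
      case False
      then show ?thesis
        using card_covered_above_large[OF B A(1), of I i j] that A(2) \<open>i \<in> {..j}\<close>
        by (auto simp: c_def Gr_between_def)
    qed
    then show "(\<Sum>I\<in>Gr_between i {0} J0. \<Sum>J | J \<in> covered j B \<and> I \<subseteq> J. 1) = ?g j i * c i"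
      by (simp add: card_i)
  qed
  moreover have "0 = (\<Sum>i\<le>j. ?z i * (?g j i * ?g (?n - i) (j - i)))"
  proof -
    have "0 = (\<Sum>J\<in>Gr_between j {0} UNIV. zonal_vec j J0 J * 1)"
      using sum_zonal_vec_above[OF J0 zero_in_Gr_0] tj by simp
    also have "\<dots> = (\<Sum>i\<le>j. ?z i * (?g j i * ?g (?n - i) (j - i)))"
      unfolding sum_zonal
    proof (intro sum.cong refl arg_cong2[where f="(*)"])
      fix i assume "i \<in> {..j}"
      have "(\<Sum>J | J \<in> Gr_between j {0} UNIV \<and> I \<subseteq> J. 1) = ?g (?n - i) (j - i)"
        if "I \<in> Gr_between i {0} J0" for I
      proof -
        have "{J. J \<in> Gr_between j {0} UNIV \<and> I \<subseteq> J} = Gr_between j I UNIV"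
          using that by (auto simp: Gr_between_def)
        then show ?thesis
          using card_Gr_between[OF _ UNIV_in_Gr, of I i j] that \<open>i \<in> {..j}\<close> by (simp add: Gr_between_def)
      qed
      then show "(\<Sum>I\<in>Gr_between i {0} J0. \<Sum>J | J \<in> Gr_between j {0} UNIV \<and> I \<subseteq> J. 1) =
          ?g j i * ?g (?n - i) (j - i)"
        by (simp add: card_i)
    qed
    finally show ?thesis .
  qed
  ultimately have "(\<Sum>J\<in>covered j B. zonal_vec j J0 J) =
      (\<Sum>i\<le>j. ?z i * (?g j i * c i)) - \<kappa> * (\<Sum>i\<le>j. ?z i * (?g j i * ?g (?n - i) (j - i)))"
    by simp
  also have "\<dots> = (\<Sum>i\<le>j. ?z i * ?g j i * (c i - \<kappa> * ?g (?n - i) (j - i)))"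
    unfolding sum_distrib_left sum_subtractf[symmetric]
    by (intro sum.cong refl) (simp add: algebra_simps)
  also have "\<dots> = (\<Sum>i=Suc t..j. ?z i * ?g j i * (c i - \<kappa> * ?g (?n - i) (j - i)))"
    by (rule sum.mono_neutral_right) (auto simp: c_def)
  also have "\<dots> = (\<Sum>i=Suc t..j. ?z i * ?g j i * (?g (k - i) (j - i) - \<kappa> * ?g (?n - i) (j - i)))"
    by (intro sum.cong refl) (auto simp: c_def)
  finally show ?thesis unfolding \<kappa>_def .
qed

section \<open>Functions annihilating all Steiner systems\<close>

lemma GL_image_steiner:
  fixes B :: "('a::{field,finite} ^ 'n::finite) set set"
  assumes f: "f \<in> GL" and B: "B \<in> q_steiner_systems t k"
  shows "(`) f ` B \<in> q_steiner_systems t k"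
proof -
  have "\<exists>!A. A \<in> (`) f ` B \<and> T \<subseteq> A" if T: "T \<in> Gr t" for T
  proof -
    have "inv f ` T \<in> Gr t" using GL_image_Gr[OF GL_inv[OF f] T] .
    then have ex1: "\<exists>!A. A \<in> B \<and> inv f ` T \<subseteq> A" by (rule steiner_block_ex1[OF B])
    have iff: "T \<subseteq> f ` A \<longleftrightarrow> inv f ` T \<subseteq> A" for A
      using GL_image_subset_iff[OF f, of "inv f ` T" A] GL_image_inv(1)[OF f] by simp
    from ex1 obtain A where A: "A \<in> B" "inv f ` T \<subseteq> A"
      and uniq: "\<forall>A'. A' \<in> B \<and> inv f ` T \<subseteq> A' \<longrightarrow> A' = A" by (elim ex1E conjE)
    show ?thesis
    proof (intro ex1I[of _ "f ` A"] conjI)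
      show "f ` A \<in> (`) f ` B" using A by (intro imageI)
      show "T \<subseteq> f ` A" using A by (simp only: iff)
      fix A' assume "A' \<in> (`) f ` B \<and> T \<subseteq> A'"
      then obtain A'' where "A' = f ` A''" "A'' \<in> B" "T \<subseteq> f ` A''" by (elim conjE imageE) simp
      with uniq show "A' = f ` A" by (simp only: iff)
    qed
  qed
  moreover have "(`) f ` B \<subseteq> Gr k"
    using steiner_subset_Gr[OF B] GL_image_Gr[OF f] by blast
  ultimately show ?thesis by (simp add: q_steiner_systems_def)
qed

text \<open>The array of the \<open>gauss_binomial q d i\<close> is triangular with unit diagonal,
  so the new coefficient corrects the value at \<open>Suc j\<close> without changing those at
  smaller \<open>d\<close>.\<close>

lemma gauss_binomial_expansion:
  assumes "q \<ge> 2"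
  shows "\<exists>\<nu>. \<forall>d\<le>j. \<phi> d = (\<Sum>i\<le>j. \<nu> i * gauss_binomial q d i)"
proof (induction j)
  case 0
  show ?case by (rule exI[of _ \<phi>]) simp
next
  case (Suc j)
  then obtain \<nu> where \<nu>: "\<forall>d\<le>j. \<phi> d = (\<Sum>i\<le>j. \<nu> i * gauss_binomial q d i)" by auto
  define \<mu> where "\<mu> = \<nu>(Suc j := \<phi> (Suc j) - (\<Sum>i\<le>j. \<nu> i * gauss_binomial q (Suc j) i))"
  have "\<phi> d = (\<Sum>i\<le>Suc j. \<mu> i * gauss_binomial q d i)" if "d \<le> Suc j" for d
  proof -
    have "(\<Sum>i\<le>j. \<mu> i * gauss_binomial q d i) = (\<Sum>i\<le>j. \<nu> i * gauss_binomial q d i)"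
      by (intro sum.cong refl) (auto simp: \<mu>_def)
    moreover have "d \<le> j \<or> d = Suc j" using that by auto
    ultimately show ?thesis using \<nu> assms by (auto simp: \<mu>_def)
  qed
  then show ?case by blast
qed

text \<open>The kernel \<open>N\<close> collects Steiner systems that all cover \<open>J0\<close>;
  being invariant it is zonal, with coefficients \<nu>. That it annihilates \<open>h\<close> is an
  equation for \<open>h J0\<close> whose other terms come from lower levels, and it can be solved
  once \<open>\<nu> j \<noteq> 0\<close>.\<close>

lemma annihilator_descent:
  fixes h :: "('a::{field,finite} ^ 'n::finite) set \<Rightarrow> rat" and B0 :: "('a ^ 'n) set set"
  assumes ex: "B0 \<in> q_steiner_systems t k" and tj: "t < j" and jk: "j \<le> k"
    and kn: "2 * k \<le> CARD('n)"
    and ann: "\<And>B. B \<in> q_steiner_systems t k \<Longrightarrow> (\<Sum>J\<in>covered j B. h J) = 0"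
  shows "\<exists>c. \<forall>J \<in> Gr j. h J = (\<Sum>I\<in>Gr_between (j - 1) {0} J. c I)"
proof -
  let ?g = "gauss_binomial CARD('a)" and ?n = "CARD('n)"
  have "t \<le> ?n" using tj jk kn by simp
  then obtain T :: "('a ^ 'n) set" where T: "T \<in> Gr t"
    by (rule Gr_subspace_exists[OF UNIV_in_Gr])
  obtain A0 where A0: "A0 \<in> B0"
    using ex1_implies_ex[OF steiner_block_ex1[OF ex T]] by blast
  then have A0k: "A0 \<in> Gr k" using steiner_subset_Gr[OF ex] by (rule subsetD[rotated])
  obtain J1 where J1: "J1 \<in> Gr j" "J1 \<subseteq> A0"
    using Gr_subspace_exists[OF A0k jk] .
  \<comment> \<open>For \<open>J0 \<in> Gr j\<close> this is a coset of the stabiliser of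
    \<open>J1\<close>. As \<open>J1\<close> lies in the block \<open>A0\<close>, each resulting
    image of \<open>B0\<close> has a block containing \<open>J0\<close>.\<close>
  define stab where "stab J0 = {f \<in> GL. f ` J1 = J0}" for J0
  define N where "N J0 J = rat_of_nat (card {f \<in> stab J0. J \<in> covered j ((`) f ` B0)})" for J0 J
  have inv: "N (f ` J0) (f ` J) = N J0 J" if f: "f \<in> GL" and "J0 \<in> Gr j" "J \<in> Gr j" for f J0 J
  proof -
    have cov: "f ` J \<in> covered j ((`) (f \<circ> g) ` B0) \<longleftrightarrow> J \<in> covered j ((`) g ` B0)" for g
    proof -
      have "f ` J \<subseteq> (f \<circ> g) ` A \<longleftrightarrow> J \<subseteq> g ` A" for A
        unfolding image_comp[symmetric] by (rule GL_image_subset_iff[OF f])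
      then show ?thesis
        using GL_image_Gr[OF f \<open>J \<in> Gr j\<close>] \<open>J \<in> Gr j\<close> by (simp add: covered_def)
    qed
    have "bij_betw ((\<circ>) f) {g \<in> stab J0. J \<in> covered j ((`) g ` B0)}
        {g \<in> stab (f ` J0). f ` J \<in> covered j ((`) g ` B0)}"
    proof (rule bij_betw_byWitness[where f' = "(\<circ>) (inv f)"])
      have fi: "f \<circ> (inv f \<circ> g) = g" "inv f \<circ> (f \<circ> g) = g" for g :: "'a ^ 'n \<Rightarrow> 'a ^ 'n"
        using f by (auto simp: GL_def fun_eq_iff bij_is_surj surj_f_inv_f bij_is_inj)
      show "\<forall>g\<in>{g \<in> stab J0. J \<in> covered j ((`) g ` B0)}. inv f \<circ> (f \<circ> g) = g"
        "\<forall>g\<in>{g \<in> stab (f ` J0). f ` J \<in> covered j ((`) g ` B0)}. f \<circ> (inv f \<circ> g) = g"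
        by (intro ballI fi)+
      show "(\<circ>) f ` {g \<in> stab J0. J \<in> covered j ((`) g ` B0)}
          \<subseteq> {g \<in> stab (f ` J0). f ` J \<in> covered j ((`) g ` B0)}"
      proof (rule image_subsetI)
        fix g assume g: "g \<in> {g \<in> stab J0. J \<in> covered j ((`) g ` B0)}"
        then have "(f \<circ> g) ` J1 = f ` J0"
          unfolding image_comp[symmetric] by (simp add: stab_def)
        with g show "f \<circ> g \<in> {g \<in> stab (f ` J0). f ` J \<in> covered j ((`) g ` B0)}"
          using GL_compose[OF f] cov by (simp add: stab_def)
      qed
      show "(\<circ>) (inv f) ` {g \<in> stab (f ` J0). f ` J \<in> covered j ((`) g ` B0)}
          \<subseteq> {g \<in> stab J0. J \<in> covered j ((`) g ` B0)}"
      proof (rule image_subsetI)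
        fix g assume g: "g \<in> {g \<in> stab (f ` J0). f ` J \<in> covered j ((`) g ` B0)}"
        have "(inv f \<circ> g) ` J1 = J0"
          using g GL_image_inv(2)[OF f] unfolding image_comp[symmetric] by (simp add: stab_def)
        moreover have "J \<in> covered j ((`) (inv f \<circ> g) ` B0)"
          using g cov[of "inv f \<circ> g"] by (simp add: fi)
        ultimately show "inv f \<circ> g \<in> {g \<in> stab J0. J \<in> covered j ((`) g ` B0)}"
          using g GL_compose[OF GL_inv[OF f]] by (simp add: stab_def)
      qed
    qed
    then show ?thesis unfolding N_def by (simp add: bij_betw_same_card)
  qed
  obtain \<phi> where \<phi>: "J0 \<in> Gr j \<Longrightarrow> J \<in> Gr j \<Longrightarrow> N J0 J = \<phi> (vec.dim (J0 \<inter> J))" for J0 J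
    using GL_invariant_dim_Int[of j j N, OF inv] by metis
  obtain \<nu> where \<nu>: "\<forall>d\<le>j. \<phi> d = (\<Sum>i\<le>j. \<nu> i * ?g d i)"
    using gauss_binomial_expansion[OF two_le_CARD_field[where 'a='a], of j \<phi>] by blast
  have N_zonal: "N J0 J = zonal \<nu> j J0 J" if "J0 \<in> Gr j" "J \<in> Gr j" for J0 J
  proof -
    have "vec.dim (J0 \<inter> J) \<le> j" using dim_Int_le[of J0 J] that by (simp add: Gr_def)
    moreover have "vec.subspace (J0 \<inter> J)" using that by (simp add: Gr_def vec.subspace_inter)
    ultimately show ?thesis
      using \<phi>[OF that] \<nu> by (simp add: zonal_def card_Gr_between_0)
  qed
  \<comment> \<open>The term \<open>i = j\<close> acts as the scalar \<open>\<nu> j\<close>, since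
    only \<open>J = J0\<close> contributes. For \<open>i < j\<close> only sums of \<open>H\<close>
    above smaller spaces enter.\<close>
  have N_sum: "(\<Sum>J\<in>Gr j. N J0 J * H J) =
      (\<Sum>i<j. \<nu> i * (\<Sum>I\<in>Gr_between i {0} J0. \<Sum>J\<in>Gr_between j I UNIV. H J)) + \<nu> j * H J0"
    if J0: "J0 \<in> Gr j" for J0 and H :: "('a ^ 'n) set \<Rightarrow> rat"
  proof -
    have "(\<Sum>J\<in>Gr j. N J0 J * H J) = (\<Sum>J\<in>Gr j. zonal \<nu> j J0 J * H J)"
      by (intro sum.cong refl) (simp add: N_zonal J0)
    also have "\<dots> = (\<Sum>i\<le>j. \<nu> i * (\<Sum>I\<in>Gr_between i {0} J0. \<Sum>J\<in>Gr_between j I UNIV. H J))"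
      unfolding sum_zonal by (intro sum.cong refl arg_cong2[where f="(*)"]) (auto simp: Gr_between_def)
    also have "\<dots> = (\<Sum>i<j. \<nu> i * (\<Sum>I\<in>Gr_between i {0} J0. \<Sum>J\<in>Gr_between j I UNIV. H J)) + \<nu> j * H J0"
    proof -
      have "Gr_between j {0} J0 = {J0}" "Gr_between j J0 UNIV = {J0}"
        using J0 zero_subset_Gr[OF J0] by (auto simp: Gr_between_def dest: Gr_eq)
      then show ?thesis unfolding lessThan_Suc_atMost[symmetric] sum.lessThan_Suc by simp
    qed
    finally show ?thesis .
  qed
  have N_swap: "(\<Sum>J\<in>Gr j. N J0 J * H J) = (\<Sum>f\<in>stab J0. \<Sum>J\<in>covered j ((`) f ` B0). H J)"
    for J0 and H :: "('a ^ 'n) set \<Rightarrow> rat"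
  proof -
    have "(\<Sum>J\<in>Gr j. N J0 J * H J) =
        (\<Sum>J\<in>Gr j. \<Sum>f | f \<in> stab J0 \<and> J \<in> covered j ((`) f ` B0). H J)"
      by (simp add: N_def)
    also have "\<dots> = (\<Sum>f\<in>stab J0. \<Sum>J | J \<in> Gr j \<and> J \<in> covered j ((`) f ` B0). H J)"
      by (rule sum.swap_restrict) auto
    also have "\<dots> = (\<Sum>f\<in>stab J0. \<Sum>J\<in>covered j ((`) f ` B0). H J)"
      by (intro sum.cong refl) (auto simp: covered_def)
    finally show ?thesis .
  qed
  \<comment> \<open>\<open>N\<close> is evaluated at \<open>J1\<close> on
    \<open>zonal_vec j J1\<close>. All terms \<open>i < j\<close> are killed, so
    \<open>\<nu> j = 0\<close> would give 0; summing over the Steiner systems instead gives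
    \<open>card (stab J1)\<close> times the nonzero \<open>S\<close>.\<close>
  have "\<nu> j \<noteq> 0"
  proof
    assume 0: "\<nu> j = 0"
    define S where "S = (\<Sum>i=Suc t..j. zonal_coeff CARD('a) CARD('n) j i * ?g j i *
      (?g (k - i) (j - i) - ?g (k - t) (j - t) / ?g (?n - t) (j - t) * ?g (?n - i) (j - i)))"
    have "S \<noteq> 0"
      unfolding S_def by (rule zonal_sum_nonzero[OF two_le_CARD_field tj jk kn])
    have "of_nat (card (stab J1)) * S =
        (\<Sum>f\<in>stab J1. \<Sum>J\<in>covered j ((`) f ` B0). zonal_vec j J1 J)"
    proof -
      have "(\<Sum>J\<in>covered j ((`) f ` B0). zonal_vec j J1 J) = S" if "f \<in> stab J1" for f
        unfolding S_def
      proof (rule sum_zonal_vec_covered[OF GL_image_steiner[OF _ ex] J1(1) _ _ tj])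
        show "f \<in> GL" "f ` A0 \<in> (`) f ` B0" using that A0 by (auto simp: stab_def)
        show "J1 \<subseteq> f ` A0" using that image_mono[OF J1(2), of f] by (simp add: stab_def)
      qed
      then show ?thesis by simp
    qed
    also have "\<dots> = (\<Sum>J\<in>Gr j. N J1 J * zonal_vec j J1 J)" by (rule N_swap[symmetric])
    also have "\<dots> = 0"
    proof -
      have "(\<Sum>I\<in>Gr_between i {0} J1. \<Sum>J\<in>Gr_between j I UNIV. zonal_vec j J1 J) = 0" if "i < j" for i
        by (rule sum.neutral, rule ballI, rule sum_zonal_vec_above[OF J1(1) _ that])
          (simp add: Gr_between_def)
      then show ?thesis unfolding N_sum[OF J1(1)] 0 by simp
    qed
    finally have "stab J1 = {}" using \<open>S \<noteq> 0\<close> by simp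
    moreover have "\<exists>f\<in>GL. f ` J1 = J1"
      using GL_transitive_pairs[OF J1(1) J1(1) J1(1) J1(1)] by auto
    ultimately show False by (auto simp: stab_def)
  qed
  define H where "H I = (\<Sum>J\<in>Gr_between j I UNIV. h J)" for I
  \<comment> \<open>The Gaussian binomial is the number of \<open>(j - 1)\<close>-spaces between an
    \<open>i\<close>-space and a \<open>j\<close>-space above it; dividing by it makes the sum of
    \<open>c\<close> below \<open>J\<close> reproduce the coefficient
    \<open>- \<nu> i / \<nu> j\<close>.\<close>
  define c where "c K = (\<Sum>i<j. - \<nu> i / \<nu> j / ?g (j - i) (j - 1 - i) * (\<Sum>I\<in>Gr_between i {0} K. H I))" for K
  have "h J = (\<Sum>K\<in>Gr_between (j - 1) {0} J. c K)" if J: "J \<in> Gr j" for J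
  proof -
    have "(\<Sum>i<j. \<nu> i * (\<Sum>I\<in>Gr_between i {0} J. H I)) + \<nu> j * h J = (\<Sum>J'\<in>Gr j. N J J' * h J')"
      unfolding N_sum[OF J] H_def ..
    also have "\<dots> = 0"
      unfolding N_swap by (intro sum.neutral ballI ann GL_image_steiner[OF _ ex]) (simp add: stab_def)
    finally have "h J = - (\<Sum>i<j. \<nu> i * (\<Sum>I\<in>Gr_between i {0} J. H I)) / \<nu> j"
      using \<open>\<nu> j \<noteq> 0\<close> by (simp add: field_simps)
    also have "\<dots> = (\<Sum>i<j. - \<nu> i / \<nu> j * (\<Sum>I\<in>Gr_between i {0} J. H I))"
      by (simp add: sum_negf sum_divide_distrib)
    also have "\<dots> = (\<Sum>i<j. - \<nu> i / \<nu> j / ?g (j - i) (j - 1 - i) *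
        (\<Sum>K\<in>Gr_between (j - 1) {0} J. \<Sum>I\<in>Gr_between i {0} K. H I))"
    proof (rule sum.cong[OF refl])
      fix i assume "i \<in> {..<j}"
      then have "?g (j - i) (j - 1 - i) \<noteq> 0" by (intro gauss_binomial_CARD_neq_0) simp
      then show "- \<nu> i / \<nu> j * (\<Sum>I\<in>Gr_between i {0} J. H I) =
          - \<nu> i / \<nu> j / ?g (j - i) (j - 1 - i) *
          (\<Sum>K\<in>Gr_between (j - 1) {0} J. \<Sum>I\<in>Gr_between i {0} K. H I)"
        using sum_Gr_between_down[OF J, where i=i and j="j - 1" and A="{0}" and f=H] \<open>i \<in> {..<j}\<close>
        by simp
    qed
    also have "\<dots> = (\<Sum>K\<in>Gr_between (j - 1) {0} J. c K)"
      unfolding c_def sum_distrib_left by (rule sum.swap)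
    finally show ?thesis .
  qed
  then show ?thesis by blast
qed

text \<open>Descent from level \<open>k\<close>, where \<open>g\<close> induces itself, to level
  \<open>t\<close>, one application of \<open>annihilator_descent\<close> per level.\<close>

lemma annihilator_in_row_space:
  fixes g :: "('a::{field,finite} ^ 'n::finite) set \<Rightarrow> rat" and B0 :: "('a ^ 'n) set set"
  assumes ex: "B0 \<in> q_steiner_systems t k" and "t \<le> k" "2 * k \<le> CARD('n)"
    and ann: "\<And>B. B \<in> q_steiner_systems t k \<Longrightarrow> (\<Sum>A\<in>B. g A) = 0"
  shows "\<exists>c. \<forall>A \<in> Gr k. g A = (\<Sum>T\<in>Gr_between t {0} A. c T)"
  using \<open>t \<le> k\<close>
proof (induction t rule: inc_induct)
  case base
  have "Gr_between k {0} A = {A}" if "A \<in> Gr k" for A :: "('a ^ 'n) set"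
    using that zero_subset_Gr by (auto simp: Gr_between_def dest: Gr_eq)
  then show ?case by (intro exI[of _ g]) simp
next
  case (step j)
  then obtain h where h: "\<forall>A \<in> Gr k. g A = (\<Sum>J\<in>Gr_between (Suc j) {0} A. h J)" by auto
  \<comment> \<open>The hypothesis on \<open>g\<close> passes to \<open>h\<close>: blocks share no
    space of dimension \<open>Suc j\<close>, so the sum of \<open>g\<close> over \<open>B\<close> is
    the sum of \<open>h\<close> over the shadow.\<close>
  have "(\<Sum>J\<in>covered (Suc j) B. h J) = 0" if B: "B \<in> q_steiner_systems t k" for B
  proof -
    have sub: "B \<subseteq> Gr k" using B by (rule steiner_subset_Gr)
    have "covered (Suc j) B = (\<Union>A\<in>B. Gr_between (Suc j) {0} A)"
      using zero_subset_Gr by (auto simp: covered_def Gr_between_def)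
    then have "(\<Sum>J\<in>covered (Suc j) B. h J) = (\<Sum>A\<in>B. \<Sum>J\<in>Gr_between (Suc j) {0} A. h J)"
    proof (simp only:, intro sum.UNION_disjoint ballI impI)
      fix A A' assume A: "A \<in> B" "A' \<in> B" "A \<noteq> A'"
      have False if J: "J \<in> Gr_between (Suc j) {0} A" "J \<in> Gr_between (Suc j) {0} A'" for J
        using steiner_block_unique[OF B A(1,2), of J "Suc j"] J A(3) step.hyps
        by (simp add: Gr_between_def)
      then show "Gr_between (Suc j) {0} A \<inter> Gr_between (Suc j) {0} A' = {}" by blast
    qed simp_all
    also have "\<dots> = (\<Sum>A\<in>B. g A)" using h sub by (intro sum.cong refl) auto
    finally show ?thesis using ann[OF B] by simp
  qed
  then obtain c where c: "\<forall>J \<in> Gr (Suc j). h J = (\<Sum>I\<in>Gr_between j {0} J. c I)"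
    using annihilator_descent[OF ex, of "Suc j" h] step.hyps assms(3) by auto
  \<comment> \<open>Inducing twice is inducing once with \<open>c\<close> rescaled by the number of
    intermediate \<open>Suc j\<close>-spaces.\<close>
  have "g A = (\<Sum>T\<in>Gr_between j {0} A. gauss_binomial CARD('a) (k - j) (Suc j - j) * c T)"
    if A: "A \<in> Gr k" for A
  proof -
    have "g A = (\<Sum>J\<in>Gr_between (Suc j) {0} A. \<Sum>I\<in>Gr_between j {0} J. c I)"
      using h A c by (auto simp: Gr_between_def intro!: sum.cong)
    then show ?thesis
      using sum_Gr_between_down[OF A, where i=j and j="Suc j" and A="{0}" and f=c]
      by (simp add: sum_distrib_left)
  qed
  then show ?case by blast
qed

section \<open>Linear algebra\<close>

text \<open>A linear map that fixes \<open>x\<close> and kills a basis of \<open>S\<close> is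
  followed by a coordinate in which \<open>x\<close> is nonzero.\<close>

lemma exists_separating_functional:
  fixes S :: "('b::field ^ 'm::finite) set"
  assumes "vec.subspace S" "x \<notin> S"
  shows "\<exists>g. (\<forall>f\<in>S. (\<Sum>i\<in>UNIV. g i * f $ i) = 0) \<and> (\<Sum>i\<in>UNIV. g i * x $ i) \<noteq> 0"
proof -
  obtain B where "finite B" and B: "B \<subseteq> S" "vec.independent B" "vec.span B = S"
    and "card B = vec.dim S"
    by (rule vec.basis_subspace_exists[OF assms(1)])
  then have "vec.independent (insert x B)"
    using assms(2) by (simp add: vec.independent_insertI)
  then obtain \<phi> where lin: "Vector_Spaces.linear (*s) (*s) \<phi>"
    and \<phi>: "\<forall>b\<in>insert x B. \<phi> b = (if b = x then x else 0)"
    using vec.linear_independent_extend[of "insert x B" "\<lambda>b. if b = x then x else 0"] by blast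
  have "x \<noteq> 0" using assms vec.subspace_0 by blast
  then obtain l where l: "x $ l \<noteq> 0" by (auto simp: vec_eq_iff)
  have ev: "(\<Sum>i\<in>UNIV. \<phi> (axis i 1) $ l * f $ i) = \<phi> f $ l" for f
  proof -
    have "\<phi> f = \<phi> (\<Sum>i\<in>UNIV. f $ i *s axis i 1)" by (simp add: basis_expansion)
    also have "\<dots> = (\<Sum>i\<in>UNIV. f $ i *s \<phi> (axis i 1))"
      by (simp add: vec.linear_sum[OF lin] vec.linear_scale[OF lin])
    finally show ?thesis by (simp add: mult.commute)
  qed
  have "\<phi> b = 0" if "b \<in> B" for b
    using \<phi> that B(1) assms(2) by auto
  then have "\<phi> f = 0" if "f \<in> S" for f
    using vec.linear_eq_0_on_span[OF lin, of B f] B(3) that by simp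
  with ev \<phi> l show ?thesis by (intro exI[of _ "\<lambda>i. \<phi> (axis i 1) $ l"]) auto
qed

text \<open>Rank-nullity for the restriction to \<open>S\<close>: a basis \<open>C\<close> of the
  kernel is extended to a basis \<open>D\<close> of \<open>S\<close>, and \<open>f\<close> is
  injective on the span of \<open>D - C\<close>.\<close>

lemma dim_image_plus_kernel:
  fixes f :: "'b::field ^ 'm::finite \<Rightarrow> 'b ^ 'l::finite"
  assumes lin: "Vector_Spaces.linear (*s) (*s) f" and S: "vec.subspace S"
  shows "vec.dim S = vec.dim (f ` S) + vec.dim {x \<in> S. f x = 0}"
proof -
  let ?K = "{x \<in> S. f x = 0}"
  have K: "vec.subspace ?K"
    using vec.subspace_inter[OF S vec.linear_subspace_kernel[OF lin]] by (simp add: Collect_conj_eq)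
  obtain C where "finite C"
    and C: "C \<subseteq> ?K" "vec.independent C" "vec.span C = ?K" "card C = vec.dim ?K"
    by (rule vec.basis_subspace_exists[OF K])
  then have "C \<subseteq> S" by blast
  then obtain D where D: "C \<subseteq> D" "D \<subseteq> S" "vec.independent D" "S \<subseteq> vec.span D"
    by (rule vec.maximal_independent_subset_extend[OF _ C(2)])
  have spD: "vec.span D = S" using D vec.span_minimal[OF D(2) S] by blast
  have finD: "finite D" by (rule vec.finiteI_independent[OF D(3)])
  have cD: "card D = vec.dim S" using vec.dim_span_eq_card_independent[OF D(3)] spD by simp
  have indE: "vec.independent (D - C)" by (rule vec.independent_mono[OF D(3)]) auto
  have "C \<union> (D - C) = D" using D by auto
  then have int: "vec.dim (vec.span C \<inter> vec.span (D - C)) = 0"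
    using dim_Int_spans[of C "D - C"] D(3) by simp
  have "inj_on f (vec.span (D - C))"
    unfolding vec.linear_inj_on_iff_eq_0[OF lin vec.subspace_span]
  proof (intro ballI impI)
    fix x assume x: "x \<in> vec.span (D - C)" "f x = 0"
    then have "x \<in> S" using vec.span_mono[of "D - C" D] spD by blast
    with x C(3) have "x \<in> vec.span C \<inter> vec.span (D - C)" by simp
    with int show "x = 0" by auto
  qed
  then have "vec.dim (f ` (D - C)) = card (D - C)"
    using vec.dim_image_eq[OF lin, of "D - C"] vec.dim_eq_card_independent[OF indE] by simp
  moreover have "vec.span (f ` (D - C)) = f ` S"
  proof -
    have "f ` D \<subseteq> insert 0 (f ` (D - C))" using C(1) by auto
    then have "vec.span (f ` D) \<subseteq> vec.span (f ` (D - C))"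
      using vec.span_mono vec.span_insert_0 by blast
    moreover have "vec.span (f ` (D - C)) \<subseteq> vec.span (f ` D)" by (intro vec.span_mono) auto
    ultimately show ?thesis using vec.linear_span_image[OF lin, of D] spD by auto
  qed
  then have "vec.dim (f ` (D - C)) = vec.dim (f ` S)" by (metis vec.dim_span)
  moreover have "card D = card C + card (D - C)"
    using finD D(1) by (metis card_Diff_subset card_mono finite_subset le_add_diff_inverse)
  ultimately show ?thesis using cD C(4) by simp
qed

section \<open>The incidence matrix and designs with rational weights\<close>

definition incidence ::
    "nat \<Rightarrow> nat \<Rightarrow> rat ^ (('a::{field,finite} ^ 'n::finite) set) \<Rightarrow> rat ^ (('a ^ 'n) set)" where
  "incidence t k f = (\<chi> T. if T \<in> Gr t then \<Sum>A\<in>Gr_between k T UNIV. f $ A else 0)"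

lemma linear_incidence: "Vector_Spaces.linear (*s) (*s) (incidence t k)"
  by unfold_locales
    (auto simp: incidence_def vec_eq_iff sum.distrib sum_distrib_left)

text \<open>The transposed matrix sends \<open>c\<close> to the function it induces on
  \<open>Gr k\<close>, so the induced functions form the row space.\<close>

lemma incidence_adjoint:
  "(\<Sum>T\<in>Gr t. c T * incidence t k f $ T) = (\<Sum>A\<in>Gr k. (\<Sum>T\<in>Gr_between t {0} A. c T) * f $ A)"
proof -
  have "(\<Sum>T\<in>Gr t. c T * incidence t k f $ T) =
      (\<Sum>T\<in>Gr_between t {0} UNIV. \<Sum>A\<in>Gr_between k T UNIV. c T * f $ A)"
    unfolding Gr_conv_between[symmetric] by (intro sum.cong refl) (simp add: incidence_def sum_distrib_left)
  also have "\<dots> = (\<Sum>A\<in>Gr_between k {0} UNIV. \<Sum>T\<in>Gr_between t {0} A. c T * f $ A)"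
    by (rule sum_Gr_between_swap[symmetric])
  also have "\<dots> = (\<Sum>A\<in>Gr k. (\<Sum>T\<in>Gr_between t {0} A. c T) * f $ A)"
    unfolding Gr_conv_between[symmetric] sum_distrib_right ..
  finally show ?thesis .
qed

text \<open>The designs over the finite field with rational weights and arbitrary index
  \<open>s\<close>; Steiner systems have index 1.\<close>

definition constant_index ::
    "nat \<Rightarrow> nat \<Rightarrow> (rat ^ (('a::{field,finite} ^ 'n::finite) set)) set" where
  "constant_index t k =
    {f. (\<forall>A. A \<notin> Gr k \<longrightarrow> f $ A = 0) \<and> (\<exists>s. \<forall>T\<in>Gr t. incidence t k f $ T = s)}"

lemma subspace_constant_index: "vec.subspace (constant_index t k)"
proof -
  note lin = linear_incidence[of t k]
  show ?thesis
    unfolding vec.subspace_def constant_index_def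
    by (auto simp: vec.linear_add[OF lin] vec.linear_scale[OF lin] vec.linear_0[OF lin])
qed

lemma char_vec_in_constant_index:
  assumes "B \<in> q_steiner_systems t k"
  shows "char_vec B \<in> constant_index t k" "T \<in> Gr t \<Longrightarrow> incidence t k (char_vec B) $ T = 1"
proof -
  have sub: "B \<subseteq> Gr k" using assms by (rule steiner_subset_Gr)
  show *: "incidence t k (char_vec B) $ T = 1" if "T \<in> Gr t" for T
  proof -
    obtain A where A: "A \<in> B" "T \<subseteq> A" and uniq: "\<forall>A'. A' \<in> B \<and> T \<subseteq> A' \<longrightarrow> A' = A"
      using steiner_block_ex1[OF assms \<open>T \<in> Gr t\<close>] by (elim ex1E conjE)
    have "(\<Sum>A\<in>Gr_between k T UNIV. char_vec B $ A) = (\<Sum>A\<in>{A}. char_vec B $ A)"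
    proof (rule sum.mono_neutral_right)
      show "{A} \<subseteq> Gr_between k T UNIV" using A sub by (simp add: Gr_between_def subset_iff)
      show "\<forall>A'\<in>Gr_between k T UNIV - {A}. char_vec B $ A' = 0"
      proof
        fix A' assume "A' \<in> Gr_between k T UNIV - {A}"
        then have "A' \<notin> B" using uniq[rule_format, of A'] by (auto simp add: Gr_between_def)
        then show "char_vec B $ A' = 0" by (simp add: char_vec_def)
      qed
    qed simp
    then show ?thesis using A(1) \<open>T \<in> Gr t\<close> by (simp add: incidence_def char_vec_def)
  qed
  show "char_vec B \<in> constant_index t k"
    using sub * by (auto simp: constant_index_def char_vec_def)
qed

text \<open>A functional \<open>g\<close> vanishing on all Steiner systems is induced from some
  \<open>c\<close>, so on \<open>constant_index t k\<close> it is the index times the sum of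
  \<open>c\<close>. Index 1 of a Steiner system forces this sum to be 0, so \<open>g\<close>
  separates nothing.\<close>

lemma steiner_space_eq_constant_index:
  assumes ex: "B0 \<in> (q_steiner_systems t k :: ('a::{field,finite} ^ 'n::finite) set set set)"
    and "t \<le> k" "2 * k \<le> CARD('n)"
  shows "steiner_space TYPE('a ^ 'n) t k = constant_index t k"
proof
  show "steiner_space TYPE('a ^ 'n) t k \<subseteq> constant_index t k"
    unfolding steiner_space_def
    by (rule vec.span_minimal) (auto simp: char_vec_in_constant_index subspace_constant_index)
  show "constant_index t k \<subseteq> steiner_space TYPE('a ^ 'n) t k"
  proof (rule subsetI, rule ccontr)
    fix x :: "rat ^ (('a ^ 'n) set)"
    assume x: "x \<in> constant_index t k" and nx: "x \<notin> steiner_space TYPE('a ^ 'n) t k"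
    have "vec.subspace (steiner_space TYPE('a ^ 'n) t k)" by (simp add: steiner_space_def)
    from exists_separating_functional[OF this nx] obtain g
      where g: "\<forall>f\<in>steiner_space TYPE('a ^ 'n) t k. (\<Sum>A\<in>UNIV. g A * f $ A) = 0"
        and gx: "(\<Sum>A\<in>UNIV. g A * x $ A) \<noteq> 0"
      by (elim exE conjE)
    have restrict: "(\<Sum>A\<in>UNIV. g A * f $ A) = (\<Sum>A\<in>Gr k. g A * f $ A)" if "f \<in> constant_index t k" for f
      using that by (intro sum.mono_neutral_right) (auto simp: constant_index_def)
    have char: "(\<Sum>A\<in>UNIV. g A * char_vec B $ A) = 0" if "B \<in> q_steiner_systems t k" for B
      by (rule g[rule_format]) (use that in \<open>auto simp: steiner_space_def intro!: vec.span_base\<close>)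
    have "(\<Sum>A\<in>B. g A) = 0" if "B \<in> q_steiner_systems t k" for B
    proof -
      have "(\<Sum>A\<in>B. g A) = (\<Sum>A\<in>UNIV. g A * char_vec B $ A)"
        by (rule sum.mono_neutral_cong_left) (auto simp: char_vec_def)
      then show ?thesis using char[OF that] by simp
    qed
    then obtain c where c: "\<forall>A \<in> Gr k. g A = (\<Sum>T\<in>Gr_between t {0} A. c T)"
      using annihilator_in_row_space[OF ex assms(2,3), of g] by blast
    have pair: "(\<Sum>A\<in>UNIV. g A * f $ A) = (\<Sum>T\<in>Gr t. c T * incidence t k f $ T)"
      if "f \<in> constant_index t k" for f
      unfolding restrict[OF that] incidence_adjoint using c by (intro sum.cong refl) auto
    obtain s where s: "\<forall>T\<in>Gr t. incidence t k x $ T = s"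
      using x by (auto simp: constant_index_def)
    have "(\<Sum>T\<in>Gr t. c T) = 0"
      using pair[OF char_vec_in_constant_index(1)[OF ex]] char[OF ex]
        char_vec_in_constant_index(2)[OF ex] by simp
    moreover have "(\<Sum>A\<in>UNIV. g A * x $ A) = (\<Sum>T\<in>Gr t. c T) * s"
      unfolding pair[OF x] sum_distrib_right using s by (intro sum.cong refl) auto
    ultimately show False using gx by simp
  qed
qed

text \<open>A functional vanishing on the image is killed by the transposed matrix, hence is zero on
  \<open>Gr t\<close> by \<open>incidence_injective\<close>.\<close>

lemma image_incidence:
  assumes "t \<le> k" "t + k \<le> CARD('n::finite)"
  shows "incidence t k ` {f :: rat ^ (('a::{field,finite} ^ 'n) set). \<forall>A. A \<notin> Gr k \<longrightarrow> f $ A = 0} =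
    {f. \<forall>T. T \<notin> Gr t \<longrightarrow> f $ T = 0}" (is "incidence t k ` ?F = ?E")
proof
  show "incidence t k ` ?F \<subseteq> ?E" by (auto simp: incidence_def)
  show "?E \<subseteq> incidence t k ` ?F"
  proof (rule subsetI, rule ccontr)
    fix y assume y: "y \<in> ?E" "y \<notin> incidence t k ` ?F"
    have "vec.subspace ?F" by (rule subspace_substandard_cart)
    then have "vec.subspace (incidence t k ` ?F)"
      by (rule vec.linear_subspace_image[OF linear_incidence])
    from exists_separating_functional[OF this y(2)] obtain g
      where g: "\<forall>f\<in>incidence t k ` ?F. (\<Sum>T\<in>UNIV. g T * f $ T) = 0"
        and gy: "(\<Sum>T\<in>UNIV. g T * y $ T) \<noteq> 0"
      by (elim exE conjE)
    have restrict: "(\<Sum>T\<in>UNIV. g T * f $ T) = (\<Sum>T\<in>Gr t. g T * f $ T)" if "f \<in> ?E" for f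
      using that by (intro sum.mono_neutral_right) auto
    have "g T = 0" if "T \<in> Gr t" for T
    proof (rule incidence_injective[OF assms _ that])
      fix A :: "('a ^ 'n) set" assume A: "A \<in> Gr k"
      \<comment> \<open>Testing on a unit vector reads off one entry of the transposed image of
        \<open>g\<close>.\<close>
      have "0 = (\<Sum>T\<in>UNIV. g T * incidence t k (axis A 1) $ T)"
        using A by (intro g[rule_format, symmetric] imageI) (auto simp: axis_def)
      also have "\<dots> = (\<Sum>T\<in>Gr t. g T * incidence t k (axis A 1) $ T)"
        by (rule restrict) (auto simp: incidence_def)
      also have "\<dots> = (\<Sum>T\<in>Gr_between t {0} A. g T)"
        unfolding incidence_adjoint using A by (simp add: axis_def if_distrib cong: if_cong)
      finally show "(\<Sum>T\<in>Gr_between t {0} A. g T) = 0" by simp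
    qed
    then show False using gy restrict[OF y(1)] by simp
  qed
qed

text \<open>The incidence map sends \<open>constant_index t k\<close> onto the line of constant
  functions on \<open>Gr t\<close>, with the same kernel as on all functions supported on
  \<open>Gr k\<close>. Rank-nullity is applied to both spaces.\<close>

lemma dim_constant_index:
  assumes ex: "B0 \<in> (q_steiner_systems t k :: ('a::{field,finite} ^ 'n::finite) set set set)"
    and "t \<le> k" "t + k \<le> CARD('n)"
  shows "vec.dim (constant_index t k :: (rat ^ (('a ^ 'n) set)) set) + card (Gr t :: ('a ^ 'n) set set) =
    card (Gr k :: ('a ^ 'n) set set) + 1"
proof -
  let ?F = "{f :: rat ^ (('a ^ 'n) set). \<forall>A. A \<notin> Gr k \<longrightarrow> f $ A = 0}"
  let ?C = "constant_index t k :: (rat ^ (('a ^ 'n) set)) set"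
  let ?L = "incidence t k :: _ \<Rightarrow> rat ^ (('a ^ 'n) set)"
  have ker: "{f \<in> ?C. ?L f = 0} = {f \<in> ?F. ?L f = 0}"
    by (auto simp: constant_index_def)
  have "vec.subspace ?F" by (rule subspace_substandard_cart)
  from dim_image_plus_kernel[OF linear_incidence this, of t k]
  have F: "card (Gr k :: ('a ^ 'n) set set) =
      card (Gr t :: ('a ^ 'n) set set) + vec.dim {f \<in> ?F. ?L f = 0}"
    unfolding image_incidence[OF assms(2,3)] dim_substandard_cart .
  let ?one = "?L (char_vec B0)"
  have one: "?one $ T = (if T \<in> Gr t then 1 else 0)" for T
    using char_vec_in_constant_index(2)[OF ex] by (simp add: incidence_def)
  \<comment> \<open>Some \<open>t\<close>-space must exist for the constant function to be
    nonzero.\<close>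
  have "card (Gr t :: ('a ^ 'n) set set) \<noteq> 0"
    using card_Gr[where 'a='a and 'n='n, of t] gauss_binomial_CARD_neq_0[of t "CARD('n)", where 'a='a] assms
    by (metis add_leD1 of_nat_0)
  then obtain T1 :: "('a ^ 'n) set" where "T1 \<in> Gr t" by (metis card.empty equals0I)
  then have "?one $ T1 \<noteq> 0" by (simp add: one)
  then have "?one \<noteq> 0" by (metis zero_index)
  have "?L ` ?C = vec.span {?one}"
  proof
    show "?L ` ?C \<subseteq> vec.span {?one}"
    proof (rule image_subsetI)
      fix f assume "f \<in> ?C"
      then obtain s where "\<forall>T\<in>Gr t. ?L f $ T = s" by (auto simp: constant_index_def)
      then have "?L f = s *s ?one" by (auto simp: vec_eq_iff one) (simp add: incidence_def)
      then show "?L f \<in> vec.span {?one}" by (simp add: vec.span_scale vec.span_base)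
    qed
    show "vec.span {?one} \<subseteq> ?L ` ?C"
      by (rule vec.span_minimal)
        (auto simp: char_vec_in_constant_index[OF ex]
          intro: vec.linear_subspace_image[OF linear_incidence subspace_constant_index])
  qed
  then have "vec.dim (?L ` ?C) = 1" using \<open>?one \<noteq> 0\<close> by simp
  moreover have "vec.dim ?C = vec.dim (?L ` ?C) + vec.dim {f \<in> ?C. ?L f = 0}"
    by (rule dim_image_plus_kernel[OF linear_incidence subspace_constant_index])
  ultimately show ?thesis using F unfolding ker by simp
qed

section \<open>The dimension formula\<close>

theorem theorem1p6:
  fixes q t k n :: nat
  assumes "CARD('a::{field,finite}) = q" and "CARD('n::finite) = n"
    and "1 \<le> t" and "t < k" and "k \<le> n" and "n \<ge> 2 * k"
    and "(q_steiner_systems t k :: ('a ^ 'n) set set set) \<noteq> {}"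
  shows "of_nat (vec.dim (steiner_space TYPE('a ^ 'n) t k)) =
           gauss_binomial q n k - gauss_binomial q n t + 1"
proof -
  obtain B0 where ex: "B0 \<in> (q_steiner_systems t k :: ('a ^ 'n) set set set)"
    using assms(7) by auto
  \<comment> \<open>The relation stays additive over \<open>nat\<close>; the subtraction is carried
    out only after the passage to the rationals.\<close>
  have "vec.dim (steiner_space TYPE('a ^ 'n) t k) + card (Gr t :: ('a ^ 'n) set set) =
      card (Gr k :: ('a ^ 'n) set set) + 1"
    using dim_constant_index[OF ex] steiner_space_eq_constant_index[OF ex] assms by simp
  then have "rat_of_nat (vec.dim (steiner_space TYPE('a ^ 'n) t k)) +
      of_nat (card (Gr t :: ('a ^ 'n) set set)) = of_nat (card (Gr k :: ('a ^ 'n) set set)) + 1"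
    by (metis of_nat_add of_nat_1)
  then show ?thesis
    unfolding card_Gr assms(1,2) by simp
qed

end
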